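(* Let $G$ be a connected semi-balanced directed graph with an arbitrarily fixed ribbon structure and basis. Recall that the simplices $\mathcal{Q}_T$ of the Jaeger trees $T$ of $G$ form a dissection of $\mathcal{Q}_G$. The restriction of the order $\prec$ (on spanning trees of $G$) to the Jaeger trees of $G$ induces a shelling order of this dissection. Moreover, for each Jaeger tree $T$, the number of facets of $\mathcal{Q}_T$ that lie in the union of the earlier simplices of the shelling, i.e. in $\bigcup_{T'\prec T}\mathcal{Q}_{T'}$ (union over Jaeger trees $T'\prec T$), equals the number of internally semi-passive edges in $T$ with respect to the $T$-order.
   Context: A directed graph is an orientation of a finite graph without loops and multiple edges; $\overrightarrow{th}$ denotes an edge with tail $t$ and head $h$, and $xy$ an edge whose orientation is not specified. Connectedness, cycles and spanning trees are meant in the underlying undirected graph. A cycle is semi-balanced if it has the same number of edges going in the two directions around the cycle; a directed graph is semi-balanced if all of its cycles are semi-balanced. For a directed graph $G=(V,E)$ let $\mathbf{v}\in\mathbf{R}^V$ be the standard basis vector of $v\in V$. The root polytope is $\mathcal{Q}_G=\mathrm{Conv}\{\mathbf{h}-\mathbf{t}\mid \overrightarrow{th}\in E\}\subset\mathbf{R}^V$; for a subgraph (or edge set) $S$, $\mathcal{Q}_S=\mathrm{Conv}\{\mathbf{h}-\mathbf{t}\mid \overrightarrow{th}\in S\}$. A ribbon structure on $G$ is a choice, for each vertex $x$, of a cyclic permutation of the edges incident to $x$; $xy^+$ denotes the edge following $xy$ at $x$, and $yx^+$ the edge following $yx$ at $y$. A basis is a pair $(b_0,b_0b_1)$ where $b_0$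 is a vertex and $b_0b_1$ is an edge incident to $b_0$. The tour of a spanning tree $T$ is the sequence of node-edge pairs starting with $(b_0,b_0b_1)$ such that if the current pair is $(x,xy)$ and $xy\notin T$ then the next pair is $(x,xy^+)$ (the tour skips $xy$ at $x$), while if $xy\in T$ then the next pair is $(y,yx^+)$; it stops right before $(b_0,b_0b_1)$ would become current again. (Each incident node-edge pair occurs exactly once.) A spanning tree $T$ is a Jaeger tree if for each edge $\overrightarrow{th}\notin T$ the pair $(t,th)$ precedes $(h,th)$ in the tour of $T$. The $T$-order $\leq_T$ on the edges of $G$: $\overrightarrow{th}$ is smaller than $\overrightarrow{t'h'}$ if in the tour of $T$ the pair $(t,th)$ becomes current before $(t',t'h')$. The order $\prec$: for two distinct spanning trees $T,T'$ take the maximal common initial segment of their tours; its last element is a pair $(x,\varepsilon)$ where $\varepsilon$ belongs to exactly one of the trees; $\varepsilon$ is called the first difference. We write $T'\prec T$ if either $x$ is the tail of $\varepsilon$, $\varepsilon\notin T'$ and $\varepsilon\in T$, or $x$ is the head of $\varepsilon$, $\varepsilon\notin T$ and $\varepsilon\in T'$. This is a linear order on spanning trees. For a spanning tree $T$ and $\varepsilon\in T$, the fundamental cut $C^*(T,\varepsilon)$ is the set of edges of $G$ connecting the two components of $T-\varepsilon$. The edge $\varepsilon\in T$ is internally semi-passive (with respect to an order of the edges, here the $T$-order) if, for the largest edge $\varepsilon'$ of $C^*(T,\varepsilon)$, the edges $\varepsilon$ and $\varepsilon'$ have their tails in different components of $T-\varepsilon$. A dissection of a polytope is a set of mutually interior-disjoint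 maximal dimensional simplices whose union is the polytope. A shelling order of a dissection is a listing $\sigma_1,\dots,\sigma_N$ of its simplices such that for each $i\ge 2$, the set $\sigma_i\cap\bigcup_{j<i}\sigma_j$ coincides with the union of a positive number of facets of $\sigma_i$. *)

theory Defs
  imports
    "HOL-Analysis.Analysis"
    "HOL-Library.Sublist"
    "HOL-Combinatorics.Orbits"
    "Graph_Theory.Arc_Walk"
    "Graph_Theory.Digraph_Component"
begin

section \<open>Directed graphs, cycles and spanning trees\<close>

text \<open>
  The vertex set is a finite type, so that \<open>real ^ 'v\<close> is the ambient space of the polytopes.
  An edge with tail \<open>t\<close> and head \<open>h\<close> is the pair \<open>(t, h)\<close>. An orientation of a finite graph
  without loops and multiple edges is an asymmetric relation \<open>E\<close>: asymmetry excludes both loops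
  and pairs of antiparallel edges.
\<close>

type_synonym 'v edge = "'v \<times> 'v"

definition graph_of :: "'v edge set \<Rightarrow> ('v, 'v edge) pre_digraph" where
  "graph_of S = with_proj \<lparr> pverts = UNIV, parcs = S \<rparr>"

text \<open>
  The library predicate \<open>connected\<close> on digraphs refers to the underlying undirected graph,
  but \<open>cycle\<close> (and hence \<open>forest\<close> and \<open>spanning_tree\<close>) respects the orientation. A cycle
  of the underlying undirected graph is therefore a cycle in the symmetric closure; the length
  bound excludes the closed walks \<open>a, b, a\<close> along a single edge.
\<close>

definition und_cycle :: "'v edge set \<Rightarrow> 'v edge list \<Rightarrow> bool" where
  "und_cycle S p \<longleftrightarrow>
     pre_digraph.cycle (with_proj (mk_symmetric (graph_of S))) p \<and> length p \<ge> 3"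

definition same_component :: "'v edge set \<Rightarrow> 'v \<Rightarrow> 'v \<Rightarrow> bool" where
  "same_component S u v \<longleftrightarrow> u \<rightarrow>\<^sup>*\<^bsub>with_proj (mk_symmetric (graph_of S))\<^esub> v"

definition semi_balanced :: "'v edge set \<Rightarrow> bool" where
  "semi_balanced E \<longleftrightarrow>
     (\<forall>p. und_cycle E p \<longrightarrow>
        length (filter (\<lambda>a. a \<in> E) p) = length (filter (\<lambda>a. prod.swap a \<in> E) p))"

definition und_spanning_tree :: "'v edge set \<Rightarrow> 'v edge set \<Rightarrow> bool" where
  "und_spanning_tree E T \<longleftrightarrow>
     T \<subseteq> E \<and> Digraph_Component.connected (graph_of T) \<and> (\<nexists>p. und_cycle T p)"

definition fundamental_cut :: "'v edge set \<Rightarrow> 'v edge set \<Rightarrow> 'v edge \<Rightarrow> 'v edge set" where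
  "fundamental_cut E T \<epsilon> = {f \<in> E. \<not> same_component (T - {\<epsilon>}) (fst f) (snd f)}"


section \<open>Root polytopes\<close>

definition root_polytope :: "('v::finite) edge set \<Rightarrow> (real ^ 'v) set" where
  "root_polytope S = convex hull ((\<lambda>(t, h). axis h 1 - axis t 1) ` S)"


section \<open>Ribbon structures and tours\<close>

definition incident_edges :: "'v edge set \<Rightarrow> 'v \<Rightarrow> 'v edge set" where
  "incident_edges E x = {e \<in> E. fst e = x \<or> snd e = x}"

text \<open>\<open>\<rho> x e\<close> is the edge following \<open>e\<close> at \<open>x\<close>.\<close>

type_synonym 'v ribbon = "'v \<Rightarrow> 'v edge \<Rightarrow> 'v edge"

definition ribbon_structure :: "'v edge set \<Rightarrow> 'v ribbon \<Rightarrow> bool" where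
  "ribbon_structure E \<rho> \<longleftrightarrow>
     (\<forall>x. \<rho> x permutes incident_edges E x \<and>
          (incident_edges E x \<noteq> {} \<longrightarrow> cyclic_on (\<rho> x) (incident_edges E x)))"

definition is_basis :: "'v edge set \<Rightarrow> 'v \<times> 'v edge \<Rightarrow> bool" where
  "is_basis E b \<longleftrightarrow> snd b \<in> incident_edges E (fst b)"

definition other_end :: "'v \<Rightarrow> 'v edge \<Rightarrow> 'v" where
  "other_end x e = (if fst e = x then snd e else fst e)"

definition tour_step :: "'v ribbon \<Rightarrow> 'v edge set \<Rightarrow> 'v \<times> 'v edge \<Rightarrow> 'v \<times> 'v edge" where
  "tour_step \<rho> T = (\<lambda>(x, e).
     if e \<in> T then (other_end x e, \<rho> (other_end x e) e) else (x, \<rho> x e))"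

definition tour :: "'v ribbon \<Rightarrow> 'v \<times> 'v edge \<Rightarrow> 'v edge set \<Rightarrow> ('v \<times> 'v edge) list" where
  "tour \<rho> b T = map (\<lambda>k. (tour_step \<rho> T ^^ k) b)
     [0..<(LEAST n. 0 < n \<and> (tour_step \<rho> T ^^ n) b = b)]"

definition occurs_before :: "'a list \<Rightarrow> 'a \<Rightarrow> 'a \<Rightarrow> bool" where
  "occurs_before xs a b \<longleftrightarrow> (\<exists>i j. i < j \<and> j < length xs \<and> xs ! i = a \<and> xs ! j = b)"

definition jaeger_tree ::
  "'v edge set \<Rightarrow> 'v ribbon \<Rightarrow> 'v \<times> 'v edge \<Rightarrow> 'v edge set \<Rightarrow> bool" where
  "jaeger_tree E \<rho> b T \<longleftrightarrow> und_spanning_tree E T \<and>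
     (\<forall>e \<in> E - T. occurs_before (tour \<rho> b T) (fst e, e) (snd e, e))"

text \<open>The strict part of the \<open>T\<close>-order: edges are compared by their tail occurrences.\<close>

definition tour_less ::
  "'v ribbon \<Rightarrow> 'v \<times> 'v edge \<Rightarrow> 'v edge set \<Rightarrow> 'v edge \<Rightarrow> 'v edge \<Rightarrow> bool" where
  "tour_less \<rho> b T e f \<longleftrightarrow> occurs_before (tour \<rho> b T) (fst e, e) (fst f, f)"

text \<open>\<open>tree_prec \<rho> b T' T\<close> is the relation \<open>T' \<prec> T\<close>.\<close>

definition tree_prec ::
  "'v ribbon \<Rightarrow> 'v \<times> 'v edge \<Rightarrow> 'v edge set \<Rightarrow> 'v edge set \<Rightarrow> bool" where
  "tree_prec \<rho> b T' T \<longleftrightarrow> T' \<noteq> T \<and>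
     (let (x, \<epsilon>) = last (longest_common_prefix (tour \<rho> b T') (tour \<rho> b T)) in
        (x = fst \<epsilon> \<and> \<epsilon> \<notin> T' \<and> \<epsilon> \<in> T) \<or> (x = snd \<epsilon> \<and> \<epsilon> \<notin> T \<and> \<epsilon> \<in> T'))"

definition internally_semi_passive ::
  "'v edge set \<Rightarrow> ('v edge \<Rightarrow> 'v edge \<Rightarrow> bool) \<Rightarrow> 'v edge set \<Rightarrow> 'v edge \<Rightarrow> bool" where
  "internally_semi_passive E lt T \<epsilon> \<longleftrightarrow> \<epsilon> \<in> T \<and>
     (\<exists>\<epsilon>' \<in> fundamental_cut E T \<epsilon>.
        (\<forall>f \<in> fundamental_cut E T \<epsilon>. f \<noteq> \<epsilon>' \<longrightarrow> lt f \<epsilon>') \<and>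
        \<not> same_component (T - {\<epsilon>}) (fst \<epsilon>) (fst \<epsilon>'))"


section \<open>Dissections and shellings\<close>

text \<open>
  The polytopes need not be full-dimensional in the ambient space, so interiors are relative.
\<close>

definition dissection :: "('a::euclidean_space) set \<Rightarrow> 'a set set \<Rightarrow> bool" where
  "dissection P D \<longleftrightarrow>
     (\<forall>\<sigma>\<in>D. aff_dim P simplex \<sigma>) \<and>
     (\<forall>\<sigma>\<in>D. \<forall>\<tau>\<in>D. \<sigma> \<noteq> \<tau> \<longrightarrow> rel_interior \<sigma> \<inter> rel_interior \<tau> = {}) \<and>
     \<Union>D = P"

definition shelling_order :: "('a::euclidean_space) set set \<Rightarrow> 'a set list \<Rightarrow> bool" where
  "shelling_order D \<sigma>s \<longleftrightarrow> distinct \<sigma>s \<and> set \<sigma>s = D \<and>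
     (\<forall>i. 0 < i \<and> i < length \<sigma>s \<longrightarrow>
        (\<exists>\<F>. \<F> \<noteq> {} \<and> (\<forall>F\<in>\<F>. F facet_of (\<sigma>s ! i)) \<and>
             \<sigma>s ! i \<inter> (\<Union>j<i. \<sigma>s ! j) = \<Union>\<F>))"

end

theory Submission
  imports Defs
begin

text \<open>
  A semi-balanced digraph has a potential that grows by one along every edge. All edge vectors
  \<open>h - t\<close> therefore lie on a hyperplane that misses the origin, and a spanning tree \<open>T\<close>, whose edge
  vectors are linearly independent, spans a simplex. The barycentric coordinate of a point at
  \<open>\<epsilon> \<in> T\<close> is the value of the functional summing the coordinates on the head side of the
  fundamental cut of \<open>\<epsilon>\<close> (\<open>cut_form_sum\<close>). This turns the geometry into the combinatorics of cuts.

  The link between cuts and tours is that the tour of \<open>T\<close> visits the side of \<open>T - \<epsilon>\<close> that does not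
  contain the base vertex during one contiguous excursion, between its two passages along \<open>\<epsilon>\<close>
  (\<open>tour_split\<close>, \<open>tour_far_side\<close>). It holds because adding an edge to a forest composes the tour
  permutation with a transposition, which splices two of its cycles.

  Let \<open>T' \<prec> T\<close> be Jaeger trees. Their tours separate at the tail of an edge \<open>\<epsilon> \<in> T - T'\<close>, and any
  edge that crosses the fundamental cut of \<open>\<epsilon>\<close> in the direction of \<open>\<epsilon>\<close> is \<open>\<epsilon>\<close> or has been skipped by
  both tours before that moment. So \<open>T'\<close> crosses the cut only against the direction of \<open>\<epsilon>\<close>; the cut
  functional is nonnegative on the simplex of \<open>T\<close> and nonpositive on that of \<open>T'\<close>, and the two
  meet inside the facet opposite to \<open>\<epsilon>\<close> (\<open>jaeger_intersection\<close>). In particular the simplices have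
  disjoint interiors.

  Conversely, let \<open>\<epsilon>\<close> be an edge of \<open>T\<close> pointing away from the base whose fundamental cut contains
  an edge \<open>f\<close> of the opposite direction; call it replaceable. Then \<open>T - \<epsilon> + f\<close> is a \<open>\<prec>\<close>-smaller
  spanning tree that still contains the facet opposite to \<open>\<epsilon>\<close> (\<open>replaceable_exchange\<close>). It need not be
  a Jaeger tree, but whenever a spanning tree violates the Jaeger condition at an edge \<open>e\<close>, weight
  can be moved around the fundamental cycle of \<open>e\<close> until an edge opposite to \<open>e\<close> has weight
  zero; such an edge exists by semi-balance, and the exchange moves down in the order
  (\<open>non_jaeger_push\<close>). Hence every point of the simplex of a spanning tree lies in the
  simplex of a Jaeger tree that is not larger (\<open>jaeger_tree_below\<close>). This descent shows that the Jaeger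
  simplices cover the polytope, and that the part of the simplex of \<open>T\<close> covered by its predecessors is
  the union of the facets opposite to replaceable edges (\<open>intersection_with_earlier\<close>). Finally, the
  excursion property identifies replaceable with internally semi-passive edges
  (\<open>semi_passive_iff_replaceable\<close>).
\<close>

section \<open>Connectivity, forests and spanning trees\<close>

abbreviation und_digraph :: "'v edge set \<Rightarrow> ('v, 'v edge) pre_digraph" where
  "und_digraph S \<equiv> with_proj (mk_symmetric (graph_of S))"

lemma arcs_und_digraph: "parcs (mk_symmetric (graph_of S)) = S \<union> S\<inverse>"
  by (auto simp: parcs_mk_symmetric graph_of_def)

lemma verts_graph_of [simp]: "verts (graph_of S) = UNIV"
  by (simp add: graph_of_def)

lemma wf_und_digraph: "wf_digraph (und_digraph S)"
  by unfold_locales (auto)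

lemma cas_und_digraph: "pre_digraph.cas (und_digraph S) u p v = pre_digraph.cas (und_digraph S') u p v"
  by (induction p arbitrary: u) (simp_all add: pre_digraph.cas.simps del: cas_with_proj_eq)

lemma awalk_verts_und_digraph:
  "pre_digraph.awalk_verts (und_digraph S) u p = pre_digraph.awalk_verts (und_digraph S') u p"
  by (induction p arbitrary: u) (simp_all add: pre_digraph.awalk_verts.simps del: awalk_verts_with_proj_eq)

lemma same_component_iff: "same_component S u v \<longleftrightarrow> (u, v) \<in> (S \<union> S\<inverse>)\<^sup>*"
proof -
  have "rtrancl_on UNIV R = R\<^sup>*" for R :: "'a rel"
  proof -
    have "p \<in> rtrancl_on UNIV R" if "p \<in> R\<^sup>*" for p
      using that
    proof (induction p)
      case (Pair a b)
      thus ?case by (induction rule: rtrancl_induct) (auto intro: rtrancl_on_into_rtrancl_on)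
    qed
    thus ?thesis by (auto dest: rtrancl_on_rtranclI)
  qed
  thus ?thesis
    by (simp add: same_component_def reachable_def arcs_und_digraph)
qed

lemma connected_graph_of_iff:
  "Digraph_Component.connected (graph_of S) \<longleftrightarrow> (\<forall>u v. same_component S u v)"
  by (simp add: Digraph_Component.connected_def strongly_connected_def
      same_component_def)

lemma same_component_refl [simp]: "same_component S u u"
  by (simp add: same_component_iff)

lemma same_component_sym: "same_component S u v \<Longrightarrow> same_component S v u"
  unfolding same_component_iff
  by (metis converse_Un converse_converse rtrancl_converseD sup_commute)

lemma same_component_trans:
  "same_component S u v \<Longrightarrow> same_component S v w \<Longrightarrow> same_component S u w"
  unfolding same_component_iff by (rule rtrancl_trans)

lemma same_component_edge: "e \<in> S \<Longrightarrow> same_component S (fst e) (snd e)"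
  unfolding same_component_iff by (cases e) auto

lemma same_component_mono: "same_component S u v \<Longrightarrow> S \<subseteq> S' \<Longrightarrow> same_component S' u v"
  unfolding same_component_iff
  by (meson converse_mono rtrancl_mono subsetD sup_mono)

lemma same_component_induct [consumes 1, case_names base step]:
  assumes "same_component S u v"
    and "P u"
    and "\<And>e x y. same_component S u x \<Longrightarrow> P x \<Longrightarrow> e \<in> S \<Longrightarrow> e = (x, y) \<or> e = (y, x) \<Longrightarrow> P y"
  shows "P v"
  using assms(1)[unfolded same_component_iff]
proof (induction rule: rtrancl_induct)
  case base show ?case by fact
next
  case (step y z)
  show ?case
    using step assms(3)[of y "(y, z)" z] assms(3)[of y "(z, y)" z]
    by (auto simp: same_component_iff)
qed

text \<open>A path in \<open>S + e\<close> either avoids \<open>e\<close> or can be cut at its first entry to and last exit from \<open>e\<close>.\<close>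

lemma same_component_insertD:
  assumes "same_component (insert e S) u v"
  shows "same_component S u v
    \<or> same_component S u (fst e) \<and> same_component S (snd e) v
    \<or> same_component S u (snd e) \<and> same_component S (fst e) v"
  using assms
proof (induction rule: same_component_induct)
  case base show ?case by simp
next
  case (step f x y)
  show ?case
  proof (cases "f = e")
    case True
    hence "x = fst e \<and> y = snd e \<or> x = snd e \<and> y = fst e" using step.hyps(3) by auto
    thus ?thesis using step.IH by (auto intro: same_component_trans)
  next
    case False
    hence "same_component S x y"
      using step same_component_edge[of f S] by (auto dest: same_component_sym)
    thus ?thesis using step.IH by (meson same_component_trans)
  qed
qed

definition acyclic_edges :: "'v edge set \<Rightarrow> bool" where
  "acyclic_edges S \<longleftrightarrow> (\<forall>e\<in>S. \<not> same_component (S - {e}) (fst e) (snd e))"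

lemma acyclic_edges_subset: "acyclic_edges S \<Longrightarrow> S' \<subseteq> S \<Longrightarrow> acyclic_edges S'"
  unfolding acyclic_edges_def by (meson Diff_mono order_refl same_component_mono subsetD)

lemma acyclic_edges_insert:
  assumes "acyclic_edges S" "\<not> same_component S (fst e) (snd e)"
  shows "acyclic_edges (insert e S)"
  unfolding acyclic_edges_def
proof
  fix f assume f: "f \<in> insert e S"
  show "\<not> same_component (insert e S - {f}) (fst f) (snd f)"
  proof (cases "f = e")
    case True
    thus ?thesis using assms(2) by (metis Diff_insert2 Diff_insert_absorb insert_Diff_single
          insert_absorb same_component_edge)
  next
    case False
    hence fS: "f \<in> S" using f by simp
    show ?thesis
    proof
      assume "same_component (insert e S - {f}) (fst f) (snd f)"
      hence "same_component (insert e (S - {f})) (fst f) (snd f)"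
        using False by (simp add: insert_Diff_if)
      from same_component_insertD[OF this] show False
      proof (elim disjE conjE)
        assume "same_component (S - {f}) (fst f) (snd f)"
        thus False using assms(1) fS by (auto simp: acyclic_edges_def)
      next
        assume "same_component (S - {f}) (fst f) (fst e)" "same_component (S - {f}) (snd e) (snd f)"
        hence "same_component S (fst e) (fst f)" "same_component S (snd f) (snd e)"
          by (meson Diff_subset same_component_mono same_component_sym)+
        thus False using assms(2) same_component_edge[OF fS] same_component_trans by metis
      next
        assume "same_component (S - {f}) (fst f) (snd e)" "same_component (S - {f}) (fst e) (snd f)"
        hence "same_component S (fst f) (snd e)" "same_component S (fst e) (snd f)"
          by (meson Diff_subset same_component_mono)+
        thus False using assms(2) same_component_edge[OF fS] same_component_trans
            same_component_sym by metis
      qed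
    qed
  qed
qed

text \<open>
  The two notions of acyclicity meet in the fact that an edge lies on a cycle iff its ends stay
  connected without it; asymmetry makes sure that such a cycle has length at least three.
\<close>

lemma und_cycle_imp_not_acyclic:
  assumes "und_cycle S p"
  shows "\<not> acyclic_edges S"
proof -
  interpret D: wf_digraph "und_digraph S" by (rule wf_und_digraph)
  obtain u where p: "D.awalk u p u" "distinct (tl (D.awalk_verts u p))" "p \<noteq> []" "length p \<ge> 3"
    using assms unfolding und_cycle_def D.cycle_def by blast
  obtain a q where pq: "p = a # q" using p(3) by (cases p) auto
  define v where "v = snd a"
  have a: "a = (u, v)" and q: "D.awalk v q u"
    using p(1) unfolding pq v_def by (auto simp: D.awalk_Cons_iff simp del: awalk_verts_with_proj_eq)
  have dist: "distinct (D.awalk_verts v q)" using p(2) unfolding pq v_def by simp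
  define e where "e = (if a \<in> S then a else (v, u))"
  have eS: "e \<in> S"
    using p(1) unfolding pq e_def a by (auto simp: D.awalk_Cons_iff arcs_und_digraph)
  \<comment> \<open>A second passage along the edge of \<open>a\<close> would repeat a vertex, or give \<open>p = [(u, v), (v, u)]\<close>.\<close>
  have avoid: "c \<noteq> (u, v) \<and> c \<noteq> (v, u)" if c: "c \<in> set q" for c
  proof -
    obtain q1 q2 where q12: "q = q1 @ c # q2" using split_list[OF c] by blast
    have w: "D.awalk v q1 (fst c)" "D.awalk (snd c) q2 u"
      using q unfolding q12 by (auto simp: D.awalk_append_iff D.awalk_Cons_iff)
    have verts: "D.awalk_verts v q = D.awalk_verts v q1 @ D.awalk_verts (snd c) q2"
    proof -
      have "D.awlast v q1 = fst c" using w(1) by (rule D.awalkE)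
      thus ?thesis using D.awalk_verts_append[OF q[unfolded q12]] unfolding q12 by simp
    qed
    have ends: "fst c \<in> set (D.awalk_verts v q1)" "v \<in> set (D.awalk_verts v q1)"
      "u \<in> set (D.awalk_verts (snd c) q2)" "snd c \<in> set (D.awalk_verts (snd c) q2)"
      using w D.hd_in_awalk_verts(1) last_in_set[OF D.awalk_verts_non_Nil] by (metis D.awalk_conv)+
    show ?thesis
    proof (intro conjI notI)
      assume "c = (u, v)" thus False using dist ends unfolding verts by auto
    next
      assume c: "c = (v, u)"
      have "q1 = []"
      proof (rule ccontr)
        assume "q1 \<noteq> []"
        hence "D.awlast v q1 \<in> set (tl (D.awalk_verts v q1))"
          by (cases q1) auto
        hence "D.awlast v q1 \<noteq> D.awhd v q1"
          using dist unfolding verts by (cases "D.awalk_verts v q1") auto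
        thus False using w(1) c by (auto elim!: D.awalkE)
      qed
      moreover have "q2 = []"
      proof (rule ccontr)
        assume "q2 \<noteq> []"
        hence "D.awlast u q2 \<in> set (tl (D.awalk_verts u q2))"
          by (cases q2) auto
        hence "D.awlast u q2 \<noteq> D.awhd u q2"
          using dist c unfolding verts by (cases "D.awalk_verts u q2") auto
        thus False using w(2) c by (auto elim!: D.awalkE)
      qed
      ultimately show False using p(4) q12 pq by simp
    qed
  qed
  have "D.awalk v q u \<Longrightarrow> same_component (S - {e}) v u"
    if "\<forall>c\<in>set q. c \<noteq> (u, v) \<and> c \<noteq> (v, u)" for q
  proof -
    assume w: "D.awalk v q u"
    interpret D': wf_digraph "und_digraph (S - {e})" by (rule wf_und_digraph)
    have "set q \<subseteq> arcs (und_digraph (S - {e}))"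
      using w that unfolding D.awalk_conv by (auto simp: arcs_und_digraph e_def a split: if_splits)
    hence "D'.awalk v q u"
      using w cas_und_digraph[of "S - {e}" v q u S] unfolding D'.awalk_def D.awalk_def by simp
    thus ?thesis unfolding same_component_def by (rule D'.reachable_awalkI)
  qed
  hence "same_component (S - {e}) v u" using avoid q by blast
  hence "same_component (S - {e}) (fst e) (snd e)"
    unfolding e_def a by (auto intro: same_component_sym)
  thus ?thesis using eS by (auto simp: acyclic_edges_def)
qed

lemma not_acyclic_imp_und_cycle:
  assumes "asym S" "\<not> acyclic_edges S"
  shows "\<exists>p. und_cycle S p"
proof -
  obtain e where e: "e \<in> S" "same_component (S - {e}) (fst e) (snd e)"
    using assms(2) by (auto simp: acyclic_edges_def)
  interpret D: wf_digraph "und_digraph S" by (rule wf_und_digraph)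
  interpret D': wf_digraph "und_digraph (S - {e})" by (rule wf_und_digraph)
  obtain p where p: "D'.apath (snd e) p (fst e)"
    using same_component_sym[OF e(2)] unfolding same_component_def D'.reachable_apath by blast
  have w: "D.awalk (snd e) p (fst e)"
    using p cas_und_digraph[of "S - {e}" "snd e" p "fst e" S] unfolding D'.apath_def D'.awalk_def D.awalk_def
    by (auto simp: arcs_und_digraph)
  have dist: "distinct (D.awalk_verts (snd e) p)"
    using p awalk_verts_und_digraph[of S "snd e" p "S - {e}"] unfolding D'.apath_def by simp
  have "D.awalk (fst e) (e # p) (fst e)"
    using w e(1) by (auto simp: D.awalk_Cons_iff arcs_und_digraph)
  moreover have "length p \<ge> 2"
  proof (rule ccontr)
    assume "\<not> length p \<ge> 2"
    then consider "p = []" | a where "p = [a]" by (cases p; cases "tl p") auto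
    thus False
    proof cases
      case 1
      hence "fst e = snd e" using w by (simp add: D.awalk_Nil_iff)
      thus False using assms(1) e(1) by (metis asymD prod.collapse)
    next
      case 2
      hence "a = (snd e, fst e)" "a \<in> (S - {e}) \<union> (S - {e})\<inverse>"
        using p unfolding D'.apath_def
        by (auto simp: D'.awalk_Cons_iff D'.awalk_Nil_iff arcs_und_digraph prod_eq_iff)
      thus False using assms(1) e(1) by (cases e) (auto dest: asymD)
    qed
  qed
  ultimately have "und_cycle S (e # p)"
    using dist unfolding und_cycle_def D.cycle_def by auto
  thus ?thesis by blast
qed

lemma und_spanning_tree_iff:
  assumes "asym E"
  shows "und_spanning_tree E T \<longleftrightarrow>
    T \<subseteq> E \<and> (\<forall>u v. same_component T u v) \<and> acyclic_edges T"
proof -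
  have "(\<nexists>p. und_cycle T p) \<longleftrightarrow> acyclic_edges T" if "T \<subseteq> E"
  proof -
    have "asym T" using assms that by (intro asymI) (auto dest: asymD)
    thus ?thesis using und_cycle_imp_not_acyclic not_acyclic_imp_und_cycle by blast
  qed
  thus ?thesis unfolding und_spanning_tree_def connected_graph_of_iff by blast
qed

section \<open>The height function of a semi-balanced digraph\<close>

text \<open>
  A closed walk that repeats an inner vertex splits into two shorter ones. Otherwise it is a cycle, or
  a loop, or a walk along one edge and back; the last two have weight zero because reversing an arc
  changes the sign of its weight.
\<close>

lemma closed_walk_weight:
  assumes semi: "semi_balanced E"
    and walk: "pre_digraph.awalk (und_digraph E) u p u"
  shows "(\<Sum>a\<leftarrow>p. of_bool (a \<in> E) - of_bool (prod.swap a \<in> E) :: real) = 0"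
    (is "sum_list (map ?w p) = 0")
  using walk
proof (induction "length p" arbitrary: p u rule: less_induct)
  case less
  interpret D: wf_digraph "und_digraph E" by (rule wf_und_digraph)
  have count: "sum_list (map ?w q) =
    real (length (filter (\<lambda>a. a \<in> E) q)) - real (length (filter (\<lambda>a. prod.swap a \<in> E) q))" for q
    by (induction q) auto
  show ?case
  proof (cases p)
    case Nil
    thus ?thesis by simp
  next
    case (Cons a q)
    have a: "fst a = u" and q: "D.awalk (snd a) q u"
      using less.prems unfolding Cons by (auto simp: D.awalk_Cons_iff)
    show ?thesis
    proof (cases "distinct (D.awalk_verts (snd a) q)")
      case True
      consider "length p \<ge> 3" | "q = []" | c where "q = [c]"
        unfolding Cons by (cases q; cases "tl q") auto
      thus ?thesis
      proof cases
        case 1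
        have "und_cycle E p"
          unfolding und_cycle_def D.cycle_def
        proof (intro conjI exI)
          show "D.awalk u p u" by (rule less.prems)
          show "distinct (tl (D.awalk_verts u p))" using True unfolding Cons by simp
        qed (use 1 Cons in auto)
        thus ?thesis using semi unfolding count semi_balanced_def by simp
      next
        case 2
        hence "prod.swap a = a" using a q by (cases a) (simp add: D.awalk_Nil_iff)
        thus ?thesis using 2 Cons by simp
      next
        case 3
        hence "c = prod.swap a" using a q by (auto simp: D.awalk_Cons_iff D.awalk_Nil_iff prod_eq_iff)
        thus ?thesis using 3 Cons by simp
      qed
    next
      case False
      obtain q1 r s where dec: "q = q1 @ r @ s" "D.closed_w r"
        "\<exists>w. D.awalk (snd a) q1 w \<and> D.awalk w r w \<and> D.awalk w s u"
        by (rule D.awalk_cyc_decompE'[OF q False]) blast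
      then obtain w where w: "D.awalk (snd a) q1 w" "D.awalk w r w" "D.awalk w s u" by blast
      have r: "r \<noteq> []" using dec(2) by (auto simp: D.closed_w_def)
      have "D.awalk (snd a) (q1 @ s) u" using w by (auto intro: D.awalk_appendI)
      hence "D.awalk u (a # q1 @ s) u"
        using less.prems unfolding Cons by (simp add: D.awalk_Cons_iff)
      hence "sum_list (map ?w (a # q1 @ s)) = 0"
        by (intro less.hyps) (use r dec(1) Cons in auto)
      moreover have "sum_list (map ?w r) = 0"
        by (rule less.hyps[OF _ w(2)]) (use dec(1) Cons in auto)
      ultimately show ?thesis using dec(1) Cons by simp
    qed
  qed
qed

text \<open>
  The potential of a vertex is the weight of any walk to it from a fixed vertex. An edge closes two such
  walks up to a closed walk.
\<close>

lemma semi_balanced_potential: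
  assumes "asym E" "semi_balanced E" "\<And>u v. same_component E u v"
  obtains \<pi> :: "'v \<Rightarrow> real" where "\<And>e. e \<in> E \<Longrightarrow> \<pi> (snd e) = \<pi> (fst e) + 1"
proof -
  fix r :: 'v
  interpret D: wf_digraph "und_digraph E" by (rule wf_und_digraph)
  define w :: "'v edge \<Rightarrow> real" where "w = (\<lambda>a. of_bool (a \<in> E) - of_bool (prod.swap a \<in> E))"
  have "\<exists>p. D.awalk u p v" for u v
    using assms(3)[of u v] unfolding same_component_def D.reachable_awalk .
  then obtain P where P: "\<And>u v. D.awalk u (P u v) v" by metis
  have zero: "sum_list (map w p) = 0" if "D.awalk r p r" for p
    using closed_walk_weight[OF assms(2) that] unfolding w_def .
  have "sum_list (map w (P r (snd e))) = sum_list (map w (P r (fst e))) + 1" if e: "e \<in> E" for e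
  proof -
    have "D.awalk (fst e) (e # P (snd e) r) r"
      using P e by (auto simp: D.awalk_Cons_iff arcs_und_digraph)
    hence "sum_list (map w (P r (fst e) @ e # P (snd e) r)) = 0"
      using P by (intro zero) (blast intro: D.awalk_appendI)
    moreover have "sum_list (map w (P r (snd e) @ P (snd e) r)) = 0"
      using P by (intro zero) (blast intro: D.awalk_appendI)
    moreover have "w e = 1"
      using e assms(1) unfolding w_def by (cases e) (auto dest: asymD)
    ultimately show ?thesis by simp
  qed
  thus thesis by (rule that)
qed

section \<open>Edge vectors and cut functionals\<close>

definition edge_vec :: "('v::finite) edge \<Rightarrow> real ^ 'v" where
  "edge_vec e = axis (snd e) 1 - axis (fst e) 1"

definition cut_form :: "'v set \<Rightarrow> real ^ ('v::finite) \<Rightarrow> real" where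
  "cut_form B x = (\<Sum>v\<in>B. x $ v)"

definition head_side :: "'v edge set \<Rightarrow> 'v edge \<Rightarrow> 'v set" where
  "head_side T f = {v. same_component (T - {f}) (snd f) v}"

lemma root_polytope_eq: "root_polytope S = convex hull (edge_vec ` S)"
  unfolding root_polytope_def edge_vec_def by (simp add: case_prod_beta')

lemma root_polytope_mono: "S \<subseteq> S' \<Longrightarrow> root_polytope S \<subseteq> root_polytope S'"
  unfolding root_polytope_eq by (intro hull_mono image_mono)

lemma linear_cut_form: "linear (cut_form B)"
  by (rule linearI) (simp_all add: cut_form_def sum.distrib sum_distrib_left)

lemma cut_form_edge_vec:
  "cut_form B (edge_vec e) = of_bool (snd e \<in> B) - of_bool (fst e \<in> B)"
  unfolding cut_form_def edge_vec_def
  by (simp add: axis_def sum_subtractf of_bool_def)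

lemma inj_on_edge_vec:
  assumes "asym S"
  shows "inj_on edge_vec S"
proof (rule inj_onI)
  fix e f assume ef: "e \<in> S" "f \<in> S" "edge_vec e = edge_vec f"
  have "fst e \<noteq> snd e" "fst f \<noteq> snd f"
    using ef assms by (metis asymD prod.collapse)+
  moreover have "cut_form {v} (edge_vec e) = cut_form {v} (edge_vec f)" for v
    using ef(3) by simp
  note this[of "fst e"] this[of "snd e"]
  ultimately show "e = f"
    by (auto simp: cut_form_edge_vec prod_eq_iff of_bool_def split: if_splits)
qed

lemma sum_edge_vec_image:
  assumes "inj_on edge_vec S"
  shows "(\<Sum>x\<in>edge_vec ` S. u x *\<^sub>R x) = (\<Sum>e\<in>S. u (edge_vec e) *\<^sub>R edge_vec e)"
    and "sum u (edge_vec ` S) = (\<Sum>e\<in>S. u (edge_vec e))"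
  using assms by (simp_all add: sum.reindex)

lemma root_polytope_iff:
  assumes "inj_on edge_vec S"
  shows "p \<in> root_polytope S \<longleftrightarrow>
    (\<exists>c. (\<forall>e\<in>S. 0 \<le> c e) \<and> sum c S = 1 \<and> p = (\<Sum>e\<in>S. c e *\<^sub>R edge_vec e))"
proof
  assume "p \<in> root_polytope S"
  moreover have "finite (edge_vec ` S)" by simp
  ultimately obtain u where "\<forall>x\<in>edge_vec ` S. 0 \<le> u x" "sum u (edge_vec ` S) = 1"
    "(\<Sum>x\<in>edge_vec ` S. u x *\<^sub>R x) = p"
    unfolding root_polytope_eq convex_hull_finite[OF \<open>finite (edge_vec ` S)\<close>] by blast
  thus "\<exists>c. (\<forall>e\<in>S. 0 \<le> c e) \<and> sum c S = 1 \<and> p = (\<Sum>e\<in>S. c e *\<^sub>R edge_vec e)"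
    unfolding sum_edge_vec_image[OF assms]
    by (intro exI[of _ "\<lambda>e. u (edge_vec e)"]) auto
next
  assume "\<exists>c. (\<forall>e\<in>S. 0 \<le> c e) \<and> sum c S = 1 \<and> p = (\<Sum>e\<in>S. c e *\<^sub>R edge_vec e)"
  then obtain c where c: "\<And>e. e \<in> S \<Longrightarrow> 0 \<le> c e" "sum c S = 1" "p = (\<Sum>e\<in>S. c e *\<^sub>R edge_vec e)"
    by blast
  show "p \<in> root_polytope S"
    unfolding c(3) root_polytope_eq
    by (rule convex_sum) (use c in \<open>auto intro: hull_inc convex_convex_hull\<close>)
qed

lemma span_edge_vec_coefficients:
  assumes "inj_on edge_vec S" "x \<in> span (edge_vec ` S)"
  obtains a where "x = (\<Sum>e\<in>S. a e *\<^sub>R edge_vec e)"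
proof -
  obtain u where "x = (\<Sum>y\<in>edge_vec ` S. u y *\<^sub>R y)"
    using assms(2) by (auto simp: span_finite)
  thus thesis using that[of "\<lambda>e. u (edge_vec e)"] unfolding sum_edge_vec_image[OF assms(1)] by simp
qed

lemma same_component_imp_span:
  assumes "same_component S u v"
  shows "axis v 1 - axis u 1 \<in> span (edge_vec ` S)"
  using assms
proof (induction rule: same_component_induct)
  case base show ?case by (simp add: span_zero)
next
  case (step e x y)
  have e: "edge_vec e \<in> span (edge_vec ` S)" using step by (auto intro: span_base)
  have "axis y 1 - axis u 1 = (axis x 1 - axis u 1) + edge_vec e
      \<or> axis y 1 - axis u 1 = (axis x 1 - axis u 1) - edge_vec e"
    using step.hyps(3) by (auto simp: edge_vec_def)
  thus ?case using span_add[OF step.IH e] span_diff[OF step.IH e] by metis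
qed

text \<open>
  The functionals of the fundamental cuts of a forest form the dual basis of its edge vectors.
\<close>

lemma cut_form_forest:
  assumes "acyclic_edges T" "e \<in> T" "f \<in> T"
  shows "cut_form (head_side T f) (edge_vec e) = of_bool (e = f)"
proof (cases "e = f")
  case True
  thus ?thesis
    using assms by (auto simp: cut_form_edge_vec head_side_def acyclic_edges_def dest: same_component_sym)
next
  case False
  hence "same_component (T - {f}) (fst e) (snd e)" using assms by (intro same_component_edge) auto
  thus ?thesis using False
    by (auto simp: cut_form_edge_vec head_side_def of_bool_def dest: same_component_sym same_component_trans)
qed

lemma cut_form_sum:
  fixes T :: "('v::finite) edge set"
  assumes "acyclic_edges T" "f \<in> T"
  shows "cut_form (head_side T f) (\<Sum>e\<in>T. c e *\<^sub>R edge_vec e) = c f"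
proof -
  have "cut_form (head_side T f) (\<Sum>e\<in>T. c e *\<^sub>R edge_vec e)
    = (\<Sum>e\<in>T. c e * cut_form (head_side T f) (edge_vec e))"
    by (simp add: linear_sum[OF linear_cut_form] linear_scale[OF linear_cut_form])
  also have "\<dots> = (\<Sum>e\<in>T. if e = f then c e else 0)"
    by (intro sum.cong) (use assms in \<open>auto simp: cut_form_forest\<close>)
  also have "\<dots> = c f" using assms by simp
  finally show ?thesis .
qed

lemma forest_independent:
  fixes T :: "('v::finite) edge set"
  assumes "acyclic_edges T"
  shows "inj_on edge_vec T" "independent (edge_vec ` T)"
proof -
  show inj: "inj_on edge_vec T"
  proof (rule inj_onI)
    fix e f assume ef: "e \<in> T" "f \<in> T" "edge_vec e = edge_vec f"
    have "cut_form (head_side T f) (edge_vec e) = 1"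
      using cut_form_forest[OF assms ef(2,2)] ef(3) by simp
    thus "e = f" using cut_form_forest[OF assms ef(1,2)] by (simp split: if_splits)
  qed
  show "independent (edge_vec ` T)"
  proof (rule independent_if_scalars_zero)
    fix u x assume u: "(\<Sum>x\<in>edge_vec ` T. u x *\<^sub>R x) = 0" and x: "x \<in> edge_vec ` T"
    then obtain f where f: "f \<in> T" "x = edge_vec f" by blast
    have "u (edge_vec f) = cut_form (head_side T f) (\<Sum>e\<in>T. u (edge_vec e) *\<^sub>R edge_vec e)"
      using assms f by (simp add: cut_form_sum)
    thus "u x = 0"
      using u f linear_0[OF linear_cut_form] unfolding sum_edge_vec_image[OF inj] by simp
  qed simp
qed

lemma edge_vec_expansion:
  fixes T :: "('v::finite) edge set"
  assumes "acyclic_edges T" "same_component T (fst e) (snd e)"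
  shows "edge_vec e = (\<Sum>f\<in>T. cut_form (head_side T f) (edge_vec e) *\<^sub>R edge_vec f)"
proof -
  have "edge_vec e \<in> span (edge_vec ` T)"
    using same_component_imp_span[OF assms(2)] by (simp add: edge_vec_def)
  then obtain a where a: "edge_vec e = (\<Sum>f\<in>T. a f *\<^sub>R edge_vec f)"
    by (rule span_edge_vec_coefficients[OF forest_independent(1)[OF assms(1)]])
  show ?thesis
    unfolding a by (intro sum.cong) (simp_all add: cut_form_sum[OF assms(1)])
qed

lemma root_polytope_forest:
  fixes T :: "('v::finite) edge set"
  assumes "acyclic_edges T" "f \<in> T" "p \<in> root_polytope T"
  shows "0 \<le> cut_form (head_side T f) p"
    and "p \<in> root_polytope (T - {f}) \<longleftrightarrow> cut_form (head_side T f) p = 0"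
proof -
  have inj: "inj_on edge_vec T" "inj_on edge_vec (T - {f})"
    using forest_independent(1)[OF assms(1)] by (auto intro: inj_on_diff)
  obtain c where c: "\<And>e. e \<in> T \<Longrightarrow> 0 \<le> c e" "sum c T = 1" "p = (\<Sum>e\<in>T. c e *\<^sub>R edge_vec e)"
    using assms(3) unfolding root_polytope_iff[OF inj(1)] by blast
  have cf: "cut_form (head_side T f) p = c f" unfolding c(3) by (rule cut_form_sum) fact+
  show "0 \<le> cut_form (head_side T f) p" using cf c(1) assms(2) by simp
  show "p \<in> root_polytope (T - {f}) \<longleftrightarrow> cut_form (head_side T f) p = 0"
  proof
    assume "p \<in> root_polytope (T - {f})"
    then obtain c' where "p = (\<Sum>e\<in>T - {f}. c' e *\<^sub>R edge_vec e)"
      unfolding root_polytope_iff[OF inj(2)] by blast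
    also have "\<dots> = (\<Sum>e\<in>T. (if e = f then 0 else c' e) *\<^sub>R edge_vec e)"
      by (rule sum.mono_neutral_cong_left) auto
    finally have p: "p = (\<Sum>e\<in>T. (if e = f then 0 else c' e) *\<^sub>R edge_vec e)" .
    show "cut_form (head_side T f) p = 0" unfolding p cut_form_sum[OF assms(1,2)] by simp
  next
    assume "cut_form (head_side T f) p = 0"
    hence "c f = 0" using cf by simp
    hence "sum c (T - {f}) = 1" "p = (\<Sum>e\<in>T - {f}. c e *\<^sub>R edge_vec e)"
      using c(2,3) assms(2) by (simp_all add: sum.remove)
    thus "p \<in> root_polytope (T - {f})" unfolding root_polytope_iff[OF inj(2)] using c(1) by blast
  qed
qed

section \<open>Spanning trees and their simplices\<close>

locale semi_balanced_digraph =
  fixes E :: "('v::finite) edge set"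
  assumes asym: "asym E"
    and connected: "\<And>u v. same_component E u v"
    and semi_balanced: "semi_balanced E"
begin

lemma asym_subset: "S \<subseteq> E \<Longrightarrow> asym S"
  using asym by (intro asymI) (auto dest: asymD)

lemma no_loop: "e \<in> E \<Longrightarrow> fst e \<noteq> snd e"
  using asym by (metis asymD prod.collapse)

lemma spanning_tree_iff:
  "und_spanning_tree E T \<longleftrightarrow> T \<subseteq> E \<and> (\<forall>u v. same_component T u v) \<and> acyclic_edges T"
  by (rule und_spanning_tree_iff[OF asym])

lemma spanning_treeD:
  assumes "und_spanning_tree E T"
  shows "T \<subseteq> E" "same_component T u v" "acyclic_edges T"
  using assms unfolding spanning_tree_iff by auto

lemma height_exists:
  obtains \<eta> :: "real ^ 'v \<Rightarrow> real" where "linear \<eta>" "\<And>e. e \<in> E \<Longrightarrow> \<eta> (edge_vec e) = 1"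
proof -
  obtain \<pi> :: "'v \<Rightarrow> real" where \<pi>: "\<And>e. e \<in> E \<Longrightarrow> \<pi> (snd e) = \<pi> (fst e) + 1"
    using semi_balanced_potential[OF asym semi_balanced connected] by blast
  define \<eta> where "\<eta> = (\<lambda>x::real^'v. \<Sum>v\<in>UNIV. \<pi> v * x $ v)"
  have "linear \<eta>"
    unfolding \<eta>_def by (rule linearI) (simp_all add: algebra_simps sum.distrib sum_distrib_left)
  moreover have "\<eta> (edge_vec e) = \<pi> (snd e) - \<pi> (fst e)" for e
    unfolding \<eta>_def edge_vec_def
    by (simp add: right_diff_distrib sum_subtractf axis_def if_distrib[of "\<lambda>x. _ * x"] cong: if_cong)
  ultimately show thesis using \<pi> that by auto
qed

text \<open>
  The height functional takes the value one on every edge vector, so it reads off the sum of the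
  coefficients of a combination.
\<close>

lemma sum_coefficients:
  assumes "S \<subseteq> E" "S' \<subseteq> E"
    and "(\<Sum>e\<in>S. a e *\<^sub>R edge_vec e) = (\<Sum>e\<in>S'. b e *\<^sub>R edge_vec e)"
  shows "sum a S = sum b S'"
proof -
  obtain \<eta> :: "real ^ 'v \<Rightarrow> real" where \<eta>: "linear \<eta>" "\<And>e. e \<in> E \<Longrightarrow> \<eta> (edge_vec e) = 1"
    using height_exists by blast
  have "\<eta> (\<Sum>e\<in>S. a e *\<^sub>R edge_vec e) = sum a S" if "S \<subseteq> E" for S and a :: "'v edge \<Rightarrow> real"
    using that \<eta> by (auto simp: linear_sum[OF \<eta>(1)] linear_scale[OF \<eta>(1)] intro!: sum.cong)
  thus ?thesis using assms by metis
qed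

text \<open>
  Moving along a linear dependency keeps the point and, by the height, the total weight; stop at
  the first edge whose weight vanishes. This single step yields both the Caratheodory-type
  reduction to forests and the exchange of edges between trees.
\<close>

lemma carry_out_dependency:
  assumes S: "S \<subseteq> E" and p: "p \<in> root_polytope S"
    and dep: "(\<Sum>e\<in>S. \<mu> e *\<^sub>R edge_vec e) = 0" and neg: "g \<in> S" "\<mu> g < 0"
  obtains f where "f \<in> S" "\<mu> f < 0" "p \<in> root_polytope (S - {f})"
proof -
  have inj: "inj_on edge_vec S" "inj_on edge_vec (S - {f})" for f
    using inj_on_edge_vec[OF asym_subset[OF S]] by (auto intro: inj_on_diff)
  obtain c where c: "\<And>e. e \<in> S \<Longrightarrow> 0 \<le> c e" "sum c S = 1" "p = (\<Sum>e\<in>S. c e *\<^sub>R edge_vec e)"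
    using p unfolding root_polytope_iff[OF inj(1)] by blast
  define N where "N = {f \<in> S. \<mu> f < 0}"
  have "finite N" "N \<noteq> {}" using neg by (auto simp: N_def simp del: split_paired_Ex split_paired_All)
  then obtain f where f: "f \<in> N" and min: "\<And>e. e \<in> N \<Longrightarrow> c f / - \<mu> f \<le> c e / - \<mu> e"
    using ex_min_if_finite[of "(\<lambda>f. c f / - \<mu> f) ` N"] by (auto simp: not_less simp del: split_paired_Ex split_paired_All)
  \<comment> \<open>the largest step along \<open>\<mu>\<close> that keeps all weights nonnegative\<close>
  define lam where "lam = c f / - \<mu> f"
  have fS: "f \<in> S" "\<mu> f < 0" using f by (auto simp: N_def)
  have lam0: "lam \<ge> 0" using fS c(1)[of f] unfolding lam_def by (intro divide_nonneg_nonneg) auto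
  define c' where "c' = (\<lambda>e. c e + lam * \<mu> e)"
  have c'f: "c' f = 0" using fS by (simp add: c'_def lam_def)
  have pos: "0 \<le> c' e" if "e \<in> S" for e
  proof (cases "\<mu> e < 0")
    case True
    hence "lam \<le> c e / - \<mu> e" using that min unfolding lam_def N_def by auto
    thus ?thesis using True unfolding c'_def by (simp add: field_simps)
  next
    case False
    thus ?thesis using lam0 c(1)[OF that] unfolding c'_def by simp
  qed
  have "p = (\<Sum>e\<in>S. c' e *\<^sub>R edge_vec e)"
  proof -
    have "(\<Sum>e\<in>S. c' e *\<^sub>R edge_vec e) = p + lam *\<^sub>R (\<Sum>e\<in>S. \<mu> e *\<^sub>R edge_vec e)"
      unfolding c(3) c'_def by (simp add: scaleR_add_left sum.distrib scaleR_sum_right)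
    thus ?thesis using dep by simp
  qed
  moreover have "sum c' S = 1"
    using sum_coefficients[OF S S] c(2,3) calculation by metis
  ultimately have "p = (\<Sum>e\<in>S - {f}. c' e *\<^sub>R edge_vec e)" "sum c' (S - {f}) = 1"
    using c'f fS by (simp_all add: sum.remove)
  hence "p \<in> root_polytope (S - {f})"
    unfolding root_polytope_iff[OF inj(2)] using pos by blast
  thus thesis using that fS by blast
qed

lemma forest_extends_to_tree:
  assumes "S \<subseteq> E" "acyclic_edges S"
  obtains T where "S \<subseteq> T" "und_spanning_tree E T"
proof -
  define \<T> where "\<T> = {T. S \<subseteq> T \<and> T \<subseteq> E \<and> acyclic_edges T}"
  have "finite \<T>" "\<T> \<noteq> {}" using assms unfolding \<T>_def by auto
  then obtain T where T: "T \<in> \<T>" and max: "\<And>T'. T' \<in> \<T> \<Longrightarrow> T \<subseteq> T' \<Longrightarrow> T' = T"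
    using finite_has_maximal[of \<T>] by metis
  have edge: "same_component T (fst e) (snd e)" if e: "e \<in> E" for e
  proof (rule ccontr)
    assume no: "\<not> same_component T (fst e) (snd e)"
    hence "insert e T \<in> \<T>" using T e acyclic_edges_insert[of T e] by (auto simp: \<T>_def)
    hence "e \<in> T" using max by blast
    thus False using no same_component_edge by blast
  qed
  have "same_component T u v" for u v
    using connected[of u v]
  proof (induction rule: same_component_induct)
    case base show ?case by simp
  next
    case (step e x y)
    have "same_component T x y"
      using edge[OF step.hyps(2)] step.hyps(3) by (auto dest: same_component_sym)
    with step.IH show ?case by (rule same_component_trans)
  qed
  thus thesis using T that unfolding spanning_tree_iff \<T>_def by blast
qed

text \<open>
  A minimal edge set whose polytope contains the point is a forest, because an edge on a cycle
  gives a dependency that removes an edge.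
\<close>

lemma root_polytope_covered_by_trees:
  assumes "p \<in> root_polytope E"
  obtains T where "und_spanning_tree E T" "p \<in> root_polytope T"
proof -
  define \<S> where "\<S> = {S. S \<subseteq> E \<and> p \<in> root_polytope S}"
  have "finite \<S>" "\<S> \<noteq> {}" using assms unfolding \<S>_def by auto
  then obtain S where S: "S \<in> \<S>" and min: "\<And>S'. S' \<in> \<S> \<Longrightarrow> S' \<subseteq> S \<Longrightarrow> S' = S"
    using finite_has_minimal[of \<S>] by metis
  have SE: "S \<subseteq> E" and pS: "p \<in> root_polytope S" using S by (auto simp: \<S>_def)
  have "acyclic_edges S"
    unfolding acyclic_edges_def
  proof (intro ballI notI)
    fix e assume e: "e \<in> S" "same_component (S - {e}) (fst e) (snd e)"
    have "edge_vec e \<in> span (edge_vec ` (S - {e}))"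
      using same_component_imp_span[OF e(2)] by (simp add: edge_vec_def)
    then obtain a where a: "edge_vec e = (\<Sum>f\<in>S - {e}. a f *\<^sub>R edge_vec f)"
    proof (rule span_edge_vec_coefficients[rotated])
      show "inj_on edge_vec (S - {e})"
        by (rule inj_on_edge_vec[OF asym_subset]) (use SE in auto)
    qed
    have "(\<Sum>f\<in>S. (if f = e then -1 else a f) *\<^sub>R edge_vec f)
      = - edge_vec e + (\<Sum>f\<in>S - {e}. (if f = e then -1 else a f) *\<^sub>R edge_vec f)"
      using e(1) by (simp add: sum.remove)
    also have "(\<Sum>f\<in>S - {e}. (if f = e then -1 else a f) *\<^sub>R edge_vec f) = edge_vec e"
      unfolding a by (intro sum.cong) auto
    finally have "(\<Sum>f\<in>S. (if f = e then -1 else a f) *\<^sub>R edge_vec f) = 0" by simp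
    moreover have "(if e = e then - 1 else a e) < 0" by simp
    ultimately obtain f where f: "f \<in> S" "p \<in> root_polytope (S - {f})"
      by (rule carry_out_dependency[OF SE pS _ e(1)]) (rule that)
    hence "S - {f} \<in> \<S>" using SE by (auto simp: \<S>_def)
    thus False using min[of "S - {f}"] f(1) by auto
  qed
  then obtain T where T: "S \<subseteq> T" "und_spanning_tree E T"
    using forest_extends_to_tree[OF SE] by blast
  thus thesis using that pS root_polytope_mono by blast
qed

lemma head_side_ends:
  assumes "und_spanning_tree E T" "f \<in> T"
  shows "snd f \<in> head_side T f" "fst f \<notin> head_side T f"
  using assms spanning_treeD(3)[OF assms(1)]
  by (auto simp: head_side_def acyclic_edges_def dest: same_component_sym)

text \<open>Deleting a tree edge leaves exactly two components, because putting it back connects everything.\<close>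

lemma same_component_minus_edge_iff:
  assumes "und_spanning_tree E T" "f \<in> T"
  shows "same_component (T - {f}) u v \<longleftrightarrow> (u \<in> head_side T f \<longleftrightarrow> v \<in> head_side T f)"
proof -
  have *: "same_component (T - {f}) (fst f) w" if "w \<notin> head_side T f" for w
  proof -
    have "same_component (insert f (T - {f})) (fst f) w"
      using spanning_treeD(2)[OF assms(1)] assms(2) by (simp add: insert_absorb)
    from same_component_insertD[OF this] that head_side_ends[OF assms] show ?thesis
      by (auto simp: head_side_def dest: same_component_sym)
  qed
  show ?thesis
    using *[of u] *[of v]
    by (auto simp: head_side_def dest: same_component_sym intro: same_component_trans)
qed

lemma exchange_spanning_tree:
  assumes T: "und_spanning_tree E T" "f \<in> T" and g: "g \<in> E"
    "(fst g \<in> head_side T f) \<noteq> (snd g \<in> head_side T f)"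
  shows "und_spanning_tree E (insert g (T - {f}))"
proof -
  have no: "\<not> same_component (T - {f}) (fst g) (snd g)"
    using g(2) unfolding same_component_minus_edge_iff[OF T] .
  let ?T = "insert g (T - {f})"
  have "acyclic_edges ?T"
    by (intro acyclic_edges_insert acyclic_edges_subset[OF spanning_treeD(3)[OF T(1)]] no) auto
  moreover have "same_component ?T u v" for u v
  proof -
    have "same_component ?T w (snd g)" for w
    proof (cases "w \<in> head_side T f \<longleftrightarrow> snd g \<in> head_side T f")
      case True
      hence "same_component (T - {f}) w (snd g)" unfolding same_component_minus_edge_iff[OF T] .
      thus ?thesis by (rule same_component_mono) auto
    next
      case False
      hence "same_component (T - {f}) w (fst g)"
        unfolding same_component_minus_edge_iff[OF T] using g(2) by auto
      hence "same_component ?T w (fst g)" by (rule same_component_mono) auto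
      thus ?thesis using same_component_edge[of g ?T] by (auto intro: same_component_trans)
    qed
    thus ?thesis by (meson same_component_sym same_component_trans)
  qed
  ultimately show ?thesis using spanning_treeD(1)[OF T(1)] g(1) unfolding spanning_tree_iff by auto
qed

text \<open>
  The coordinates of \<open>e\<close> in the basis \<open>T\<close> are \<open>1\<close>, \<open>-1\<close> and \<open>0\<close> and sum up to one, so at least one
  is positive. The edges with coordinate \<open>1\<close> are those of the fundamental cycle of \<open>e\<close> that are
  opposite to \<open>e\<close>; they lose weight when \<open>e\<close> gains some.
\<close>

lemma push_along_edge:
  assumes T: "und_spanning_tree E T" and p: "p \<in> root_polytope T" and e: "e \<in> E - T"
  obtains f where "f \<in> T" "snd e \<in> head_side T f" "fst e \<notin> head_side T f"
    "p \<in> root_polytope (insert e (T - {f}))"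
proof -
  define \<phi> where "\<phi> = (\<lambda>f. cut_form (head_side T f) (edge_vec e))"
  have exp: "edge_vec e = (\<Sum>f\<in>T. \<phi> f *\<^sub>R edge_vec f)"
    unfolding \<phi>_def by (rule edge_vec_expansion) (use spanning_treeD[OF T] in auto)
  have TE: "T \<subseteq> E" by (rule spanning_treeD(1)[OF T])
  have "sum \<phi> T = sum (\<lambda>_. 1) {e}"
    by (rule sum_coefficients) (use TE e exp in auto)
  hence "\<exists>f\<in>T. \<phi> f > 0"
    using sum_nonpos[of T \<phi>] by (force simp: not_less)
  then obtain g where g: "g \<in> T" "\<phi> g > 0" by blast
  let ?S = "insert e T"
  define \<mu> where "\<mu> = (\<lambda>f. if f = e then 1 else - \<phi> f)"
  have "(\<Sum>f\<in>T. \<mu> f *\<^sub>R edge_vec f) = - (\<Sum>f\<in>T. \<phi> f *\<^sub>R edge_vec f)"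
    unfolding sum_negf[symmetric] \<mu>_def by (intro sum.cong) (use e in auto)
  hence dep: "(\<Sum>f\<in>?S. \<mu> f *\<^sub>R edge_vec f) = 0"
    using exp e by (simp add: \<mu>_def)
  obtain f where f: "f \<in> ?S" "\<mu> f < 0" "p \<in> root_polytope (?S - {f})"
  proof (rule carry_out_dependency[of ?S p \<mu> g])
    show "p \<in> root_polytope ?S" using p root_polytope_mono[of T ?S] by blast
  qed (use TE e g dep in \<open>auto simp: \<mu>_def\<close>)
  have "f \<noteq> e" using f(2) by (auto simp: \<mu>_def)
  hence "f \<in> T" "\<phi> f > 0" "?S - {f} = insert e (T - {f})" using f by (auto simp: \<mu>_def)
  moreover from this have "snd e \<in> head_side T f" "fst e \<notin> head_side T f"
    unfolding \<phi>_def cut_form_edge_vec by (auto simp: of_bool_def split: if_splits)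
  ultimately show thesis using f(3) that by simp
qed

lemma tree_affine_independent:
  assumes "und_spanning_tree E T"
  shows "\<not> affine_dependent (edge_vec ` T)"
  using forest_independent(2)[OF spanning_treeD(3)[OF assms]] affine_dependent_imp_dependent by blast

text \<open>
  All edge vectors are affine combinations of those of the tree, since their coordinates sum up to
  one. So the simplex of the tree has the dimension of the whole polytope.
\<close>

lemma tree_simplex:
  assumes T: "und_spanning_tree E T"
  shows "aff_dim (root_polytope E) simplex root_polytope T"
proof -
  note TE = spanning_treeD(1)[OF T]
  have inj: "inj_on edge_vec T" by (rule forest_independent(1)[OF spanning_treeD(3)[OF T]])
  have "edge_vec e \<in> affine hull (edge_vec ` T)" if e: "e \<in> E" for e
  proof -
    let ?\<phi> = "\<lambda>f. cut_form (head_side T f) (edge_vec e)"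
    have exp: "edge_vec e = (\<Sum>f\<in>T. ?\<phi> f *\<^sub>R edge_vec f)"
      by (rule edge_vec_expansion) (use spanning_treeD[OF T] in auto)
    have "sum ?\<phi> T = sum (\<lambda>_. 1) {e}"
      by (rule sum_coefficients) (use TE e exp in auto)
    hence one: "sum ?\<phi> T = 1" by simp
    define u where "u = (\<lambda>x. ?\<phi> (inv_into T edge_vec x))"
    have uf: "u (edge_vec f) = ?\<phi> f" if "f \<in> T" for f
      using inj that by (simp add: u_def)
    have "sum u (edge_vec ` T) = 1 \<and> (\<Sum>x\<in>edge_vec ` T. u x *\<^sub>R x) = edge_vec e"
      unfolding sum_edge_vec_image[OF inj] using one exp uf by (simp cong: sum.cong)
    moreover have "finite (edge_vec ` T)" by simp
    ultimately show ?thesis unfolding affine_hull_finite[OF \<open>finite (edge_vec ` T)\<close>] by blast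
  qed
  hence "aff_dim (edge_vec ` E) \<le> aff_dim (edge_vec ` T)"
    by (metis aff_dim_affine_hull aff_dim_subset image_subsetI)
  moreover have "aff_dim (edge_vec ` T) \<le> aff_dim (edge_vec ` E)"
    by (intro aff_dim_subset image_mono TE)
  moreover have "aff_dim (edge_vec ` T) = int (card (edge_vec ` T)) - 1"
    using affine_independent_iff_card[of "edge_vec ` T"] tree_affine_independent[OF T] by simp
  ultimately have "int (card (edge_vec ` T)) = aff_dim (root_polytope E) + 1"
    unfolding root_polytope_eq aff_dim_convex_hull by simp
  thus ?thesis
    unfolding root_polytope_eq[of T]
    by (intro simplex_convex_hull conjI tree_affine_independent[OF T])
qed

lemma facet_of_tree_simplex_iff:
  assumes T: "und_spanning_tree E T"
  shows "F facet_of root_polytope T \<longleftrightarrow> 2 \<le> card T \<and> (\<exists>f\<in>T. F = root_polytope (T - {f}))"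
proof -
  have inj: "inj_on edge_vec T" by (rule forest_independent(1)[OF spanning_treeD(3)[OF T]])
  have "edge_vec ` (T - {f}) = edge_vec ` T - {edge_vec f}" if "f \<in> T" for f
    using inj that by (auto simp: inj_on_def)
  thus ?thesis
    unfolding root_polytope_eq facet_of_convex_hull_affine_independent_alt[OF tree_affine_independent[OF T]]
    by (auto simp: card_image[OF inj])
qed

lemma rel_interior_tree_simplex:
  assumes T: "und_spanning_tree E T" and f: "f \<in> T"
  shows "rel_interior (root_polytope T) \<inter> root_polytope (T - {f}) = {}"
proof -
  have inj: "inj_on edge_vec T" by (rule forest_independent(1)[OF spanning_treeD(3)[OF T]])
  have "edge_vec ` (T - {f}) \<subseteq> edge_vec ` T - {edge_vec f}"
    using inj f by (auto simp: inj_on_def)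
  hence "root_polytope (T - {f}) \<subseteq> convex hull (edge_vec ` T - {edge_vec f})"
    unfolding root_polytope_eq by (rule hull_mono)
  thus ?thesis
    using rel_boundary_of_convex_hull[OF tree_affine_independent[OF T]] f
    unfolding root_polytope_eq by blast
qed

end

section \<open>Lists that traverse a cycle of a map\<close>

text \<open>
  Using \<open>rotate1\<close> for the image of the list closes the cycle without index arithmetic modulo its length.
\<close>

definition traverses :: "('a \<Rightarrow> 'a) \<Rightarrow> 'a list \<Rightarrow> bool" where
  "traverses f xs \<longleftrightarrow> distinct xs \<and> map f xs = rotate1 xs"

lemma traverses_Nil [simp]: "traverses f []"
  by (simp add: traverses_def)

lemma traverses_rotate1: "traverses f xs \<Longrightarrow> traverses f (rotate1 xs)"
  by (simp add: traverses_def rotate1_map[symmetric])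

lemma traverses_append_commute: "traverses f (xs @ ys) \<Longrightarrow> traverses f (ys @ xs)"
proof (induction xs arbitrary: ys)
  case (Cons x xs)
  have "traverses f (rotate1 ((x # xs) @ ys))" by (rule traverses_rotate1) fact
  thus ?case using Cons.IH[of "ys @ [x]"] by simp
qed simp

lemma traverses_cong:
  assumes "traverses f xs" "\<And>x. x \<in> set xs \<Longrightarrow> f' x = f x"
  shows "traverses f' xs"
proof -
  have "map f' xs = map f xs" using assms(2) by simp
  thus ?thesis using assms(1) unfolding traverses_def by metis
qed

lemma traverses_starting_at:
  assumes "traverses f xs" "a \<in> set xs"
  obtains ys where "traverses f (a # ys)" "set (a # ys) = set xs"
proof -
  obtain us vs where xs: "xs = us @ a # vs" using assms(2) by (meson split_list)
  show thesis
    by (rule that[of "vs @ us"])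
      (use assms(1) traverses_append_commute[of f us "a # vs"] in \<open>auto simp: xs\<close>)
qed

lemma traverses_ending_at:
  assumes "traverses f xs" "a \<in> set xs"
  obtains ys where "traverses f (ys @ [a])" "set (ys @ [a]) = set xs"
proof -
  obtain us vs where xs: "xs = us @ a # vs" using assms(2) by (meson split_list)
  show thesis
    by (rule that[of "vs @ us"])
      (use assms(1) traverses_append_commute[of f "us @ [a]" vs] in \<open>auto simp: xs\<close>)
qed

lemma traverses_snoc_iff:
  "traverses f (us @ [a]) \<longleftrightarrow>
    distinct (us @ [a]) \<and> map f us = tl (us @ [a]) \<and> f a = hd (us @ [a])"
  by (cases us) (auto simp: traverses_def)

text \<open>
  Composing a permutation with the transposition of two points that lie on different cycles splices
  these cycles.
\<close>

lemma traverses_merge: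
  assumes f: "traverses f (us @ [a])" "traverses f (vs @ [c])"
    and disj: "set (us @ [a]) \<inter> set (vs @ [c]) = {}"
    and swap: "f' a = f c" "f' c = f a" "\<And>x. x \<in> set us \<union> set vs \<Longrightarrow> f' x = f x"
  shows "traverses f' (us @ [a] @ vs @ [c])"
proof -
  have images: "map f' us = tl (us @ [a])" "map f' vs = tl (vs @ [c])"
    "f' a = hd (vs @ [c])" "f' c = hd (us @ [a])"
    and dist: "distinct (us @ [a])" "distinct (vs @ [c])"
    using f swap unfolding traverses_snoc_iff by (simp_all cong: map_cong)
  hence "map f' (us @ [a] @ vs) = tl (us @ [a]) @ vs @ [c]"
    by (cases vs) auto
  thus ?thesis
    using traverses_snoc_iff[of f' "us @ [a] @ vs" c] disj images(4) dist
    by (cases us) auto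
qed

lemma traverses_funpow:
  assumes "traverses f (a # xs)"
  shows "(f ^^ k) a = (a # xs) ! (k mod length (a # xs))"
proof (induction k)
  case (Suc k)
  let ?n = "length (a # xs)"
  have "(f ^^ Suc k) a = map f (a # xs) ! (k mod ?n)"
    using Suc nth_map[of "k mod ?n" "a # xs" f] by (simp del: list.map)
  also have "\<dots> = (a # xs) ! (Suc (k mod ?n) mod ?n)"
    using assms unfolding traverses_def by (simp add: nth_rotate1 del: rotate1.simps list.map)
  finally show ?case by (simp add: mod_Suc_eq)
qed simp

lemma traverses_eq_orbit_list:
  assumes "traverses f (a # xs)"
  shows "map (\<lambda>k. (f ^^ k) a) [0..<LEAST n. 0 < n \<and> (f ^^ n) a = a] = a # xs"
proof -
  let ?n = "length (a # xs)"
  have dist: "distinct (a # xs)" using assms by (simp add: traverses_def)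
  have "(LEAST n. 0 < n \<and> (f ^^ n) a = a) = ?n"
  proof (rule Least_equality)
    show "0 < ?n \<and> (f ^^ ?n) a = a"
      using traverses_funpow[OF assms, of ?n] by (simp del: funpow.simps)
    fix m assume m: "0 < m \<and> (f ^^ m) a = a"
    show "?n \<le> m"
    proof (rule ccontr)
      assume "\<not> ?n \<le> m"
      hence "(a # xs) ! m = (a # xs) ! 0" using m by (simp add: traverses_funpow[OF assms])
      thus False using \<open>\<not> ?n \<le> m\<close> m dist nth_eq_iff_index_eq[OF dist, of m 0] by simp
    qed
  qed
  moreover have "map (\<lambda>k. (f ^^ k) a) [0..<?n] = a # xs"
    by (rule nth_equalityI) (simp_all add: traverses_funpow[OF assms] del: upt_Suc list.map)
  ultimately show ?thesis by simp
qed

lemma traverses_cyclic_on: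
  assumes "cyclic_on f S"
  obtains xs where "traverses f xs" "set xs = S"
proof -
  obtain s where s: "s \<in> S" "S = orbit f s" using assms by (auto simp: cyclic_on_def)
  hence so: "s \<in> orbit f s" by simp
  let ?n = "funpow_dist1 f s s"
  define m where "m = funpow_dist f (f s) s"
  define g where "g = (\<lambda>k. (f ^^ k) s)"
  have "map f (map g [0..<?n]) = map g (map Suc [0..<?n])" by (simp add: g_def)
  also have "\<dots> = map g [1..<?n] @ [g ?n]"
    unfolding map_Suc_upt by simp
  also have "g ?n = g 0" using funpow_dist1_prop[OF so] by (simp add: g_def)
  also have "map g [1..<?n] @ [g 0] = rotate1 (map g [0..<?n])"
    by (simp add: upt_conv_Cons del: upt_Suc)
  finally have "map f (map g [0..<?n]) = rotate1 (map g [0..<?n])" .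
  moreover have "distinct (map g [0..<?n])"
    using inj_on_funpow_dist1[OF so] by (simp add: distinct_map g_def del: upt_Suc)
  moreover have "set (map g [0..<?n]) = S"
    unfolding s(2) orbit_conv_funpow_dist1[OF so] by (simp add: g_def del: upt_Suc)
  ultimately show thesis using that[of "map g [0..<?n]"] by (simp add: traverses_def del: upt_Suc)
qed

section \<open>Orders on and of lists\<close>

lemma occurs_before_append:
  assumes "a \<in> set us" "c \<in> set vs"
  shows "occurs_before (us @ vs) a c"
proof -
  obtain i j where ij: "i < length us" "us ! i = a" "j < length vs" "vs ! j = c"
    using assms by (auto simp: in_set_conv_nth)
  thus ?thesis unfolding occurs_before_def
    by (intro exI[of _ i] exI[of _ "length us + j"]) (auto simp: nth_append)
qed

lemma occurs_before_irrefl: "distinct xs \<Longrightarrow> \<not> occurs_before xs a a"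
  unfolding occurs_before_def by (metis nat_neq_iff nth_eq_iff_index_eq order.strict_trans)

lemma occurs_before_trans:
  "distinct xs \<Longrightarrow> occurs_before xs a c \<Longrightarrow> occurs_before xs c d \<Longrightarrow> occurs_before xs a d"
  unfolding occurs_before_def by (metis nth_eq_iff_index_eq order.strict_trans)

lemma occurs_before_asym:
  "distinct xs \<Longrightarrow> occurs_before xs a c \<Longrightarrow> \<not> occurs_before xs c a"
  using occurs_before_irrefl occurs_before_trans by metis

lemma occurs_before_total:
  "a \<in> set xs \<Longrightarrow> c \<in> set xs \<Longrightarrow> a \<noteq> c \<Longrightarrow> occurs_before xs a c \<or> occurs_before xs c a"
  unfolding in_set_conv_nth occurs_before_def by (metis nat_neq_iff)

lemma last_longest_common_prefix:
  assumes "k < length xs" "k < length ys" "\<And>j. j \<le> k \<Longrightarrow> xs ! j = ys ! j"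
    and "Suc k < length xs \<Longrightarrow> Suc k < length ys \<Longrightarrow> xs ! Suc k \<noteq> ys ! Suc k"
  shows "longest_common_prefix xs ys \<noteq> [] \<and> last (longest_common_prefix xs ys) = xs ! k"
  using assms
proof (induction k arbitrary: xs ys)
  case 0
  then obtain x xs' y ys' where eq: "xs = x # xs'" "ys = y # ys'" by (cases xs; cases ys) auto
  have "x = y" using "0.prems"(3)[of 0] by (simp add: eq)
  moreover have "longest_common_prefix xs' ys' = []"
    using "0.prems"(4) unfolding eq by (cases xs'; cases ys') auto
  ultimately show ?case by (simp add: eq)
next
  case (Suc k)
  then obtain x xs' y ys' where eq: "xs = x # xs'" "ys = y # ys'" by (cases xs; cases ys) auto
  have "x = y" using Suc.prems(3)[of 0] by (simp add: eq)
  moreover have "longest_common_prefix xs' ys' \<noteq> [] \<and> last (longest_common_prefix xs' ys') = xs' ! k"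
    using Suc.prems(1,2) Suc.prems(3)[of "Suc _"] Suc.prems(4) unfolding eq
    by (intro Suc.IH) auto
  ultimately show ?case by (simp add: eq)
qed

lemma ex_sorted_wrt_list:
  assumes "finite A" "transp_on A R" "totalp_on A R"
  shows "\<exists>xs. distinct xs \<and> set xs = A \<and> sorted_wrt R xs"
  using assms
proof (induction A rule: finite_psubset_induct)
  case (psubset A)
  show ?case
  proof (cases "A = {}")
    case False
    then obtain m where m: "m \<in> A" "\<And>x. x \<in> A \<Longrightarrow> x \<noteq> m \<Longrightarrow> R m x"
      using Finite_Set.bex_least_element[of A R] psubset by blast
    have "A - {m} \<subset> A" using m(1) by blast
    then obtain xs where "distinct xs" "set xs = A - {m}" "sorted_wrt R xs"
      using psubset.IH[of "A - {m}"] psubset.prems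
      by (meson Diff_subset totalp_on_subset transp_on_subset)
    thus ?thesis using m by (intro exI[of _ "m # xs"]) auto
  qed (intro exI[of _ "[]"], simp)
qed

section \<open>Tours of spanning trees\<close>

locale ribbon_digraph = semi_balanced_digraph E for E :: "('v::finite) edge set" +
  fixes \<rho> :: "'v ribbon" and b :: "'v \<times> 'v edge"
  assumes ribbon: "ribbon_structure E \<rho>"
    and basis: "is_basis E b"
begin

definition pairs_at :: "'v set \<Rightarrow> ('v \<times> 'v edge) set" where
  "pairs_at A = {(x, e). x \<in> A \<and> e \<in> incident_edges E x}"

lemma pairs_at_iff: "(x, e) \<in> pairs_at A \<longleftrightarrow> x \<in> A \<and> e \<in> E \<and> (x = fst e \<or> x = snd e)"
  by (auto simp: pairs_at_def incident_edges_def)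

lemma basis_pair: "b \<in> pairs_at UNIV"
  using basis by (cases b) (auto simp: is_basis_def pairs_at_def)

text \<open>
  The cycles of the tour permutation of a forest correspond to its components. For the empty forest
  they are the cyclic orders of the ribbon structure, and adding the edge \<open>(t, h)\<close> composes the
  permutation with the transposition of its two node-edge pairs.
\<close>

lemma traverses_component:
  assumes "acyclic_edges F" "F \<subseteq> E"
  shows "\<exists>xs. traverses (tour_step \<rho> F) xs \<and> set xs = pairs_at {y. same_component F x y}"
proof -
  have "finite F" by simp
  thus ?thesis using assms
  proof (induction F arbitrary: x)
    case empty
    have comp: "{y. same_component {} x y} = {x}" by (auto simp: same_component_iff)
    show ?case
    proof (cases "incident_edges E x = {}")
      case True
      thus ?thesis unfolding comp by (intro exI[of _ "[]"]) (auto simp: pairs_at_def)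
    next
      case False
      hence "cyclic_on (\<rho> x) (incident_edges E x)" using ribbon by (auto simp: ribbon_structure_def)
      then obtain es where es: "traverses (\<rho> x) es" "set es = incident_edges E x"
        by (rule traverses_cyclic_on)
      have "map (tour_step \<rho> {}) (map (Pair x) es) = map (Pair x) (map (\<rho> x) es)"
        by (simp add: tour_step_def)
      also have "\<dots> = rotate1 (map (Pair x) es)"
        using es(1) by (simp add: traverses_def rotate1_map)
      finally have "traverses (tour_step \<rho> {}) (map (Pair x) es)"
        using es(1) by (simp add: traverses_def distinct_map inj_on_def)
      thus ?thesis unfolding comp
        by (intro exI[of _ "map (Pair x) es"]) (use es(2) in \<open>auto simp: pairs_at_def\<close>)
    qed
  next
    case (insert \<epsilon> F)
    obtain t h where \<epsilon>: "\<epsilon> = (t, h)" by (cases \<epsilon>)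
    have F: "acyclic_edges F" "F \<subseteq> E" and \<epsilon>E: "\<epsilon> \<in> E"
      using insert.prems acyclic_edges_subset by auto
    have sep: "\<not> same_component F t h"
      using insert.prems(1) insert.hyps(2) unfolding acyclic_edges_def \<epsilon> by auto
    have th: "t \<noteq> h" using no_loop[OF \<epsilon>E] by (simp add: \<epsilon>)
    let ?f = "tour_step \<rho> F" and ?f' = "tour_step \<rho> (insert \<epsilon> F)"
    have other: "?f' p = ?f p" if "p \<in> pairs_at UNIV" "p \<noteq> (t, \<epsilon>)" "p \<noteq> (h, \<epsilon>)" for p
      using that by (cases p) (auto simp: tour_step_def pairs_at_iff \<epsilon>)
    have merge: "same_component F u v \<Longrightarrow> same_component (insert \<epsilon> F) u v" for u v
      by (erule same_component_mono) auto
    have edge: "same_component (insert \<epsilon> F) t h"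
      using same_component_edge[of \<epsilon> "insert \<epsilon> F"] by (simp add: \<epsilon>)
    have split: "same_component F u v \<or> same_component F u t \<and> same_component F h v
        \<or> same_component F u h \<and> same_component F t v" if "same_component (insert \<epsilon> F) u v" for u v
      using same_component_insertD[OF that] by (simp add: \<epsilon>)
    show ?case
    proof (cases "same_component (insert \<epsilon> F) x t")
      case True
      have comp: "{y. same_component (insert \<epsilon> F) x y}
          = {y. same_component F t y} \<union> {y. same_component F h y}" (is "?L = ?A \<union> ?B")
      proof (intro equalityI subsetI)
        fix y assume "y \<in> ?L"
        hence "same_component (insert \<epsilon> F) t y" using same_component_trans[OF same_component_sym[OF True]] by simp
        from split[OF this] show "y \<in> ?A \<union> ?B" by auto
      next
        fix y assume "y \<in> ?A \<union> ?B"
        hence "same_component (insert \<epsilon> F) t y"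
          using merge same_component_trans[OF edge merge] by auto
        thus "y \<in> ?L" using same_component_trans[OF True] by simp
      qed
      obtain xs ys where xs: "traverses ?f xs" "set xs = pairs_at ?A"
        and ys: "traverses ?f ys" "set ys = pairs_at ?B"
        using insert.IH[OF F] by meson
      have "(t, \<epsilon>) \<in> set xs" "(h, \<epsilon>) \<in> set ys"
        using \<epsilon>E unfolding xs ys by (auto simp: pairs_at_iff \<epsilon>)
      obtain us where us: "traverses ?f (us @ [(t, \<epsilon>)])" "set (us @ [(t, \<epsilon>)]) = pairs_at ?A"
        using traverses_ending_at[OF xs(1) \<open>(t, \<epsilon>) \<in> set xs\<close>] xs(2) by metis
      obtain vs where vs: "traverses ?f (vs @ [(h, \<epsilon>)])" "set (vs @ [(h, \<epsilon>)]) = pairs_at ?B"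
        using traverses_ending_at[OF ys(1) \<open>(h, \<epsilon>) \<in> set ys\<close>] ys(2) by metis
      have disj: "pairs_at ?A \<inter> pairs_at ?B = {}"
        using sep by (auto simp: pairs_at_def dest: same_component_sym same_component_trans)
      have "traverses ?f' (us @ [(t, \<epsilon>)] @ vs @ [(h, \<epsilon>)])"
      proof (rule traverses_merge[OF us(1) vs(1)])
        show "set (us @ [(t, \<epsilon>)]) \<inter> set (vs @ [(h, \<epsilon>)]) = {}" using disj unfolding us vs .
        show "?f' (t, \<epsilon>) = ?f (h, \<epsilon>)" "?f' (h, \<epsilon>) = ?f (t, \<epsilon>)"
          using insert.hyps(2) th by (auto simp: tour_step_def other_end_def \<epsilon>)
        fix p assume p: "p \<in> set us \<union> set vs"
        have "distinct (us @ [(t, \<epsilon>)])" "distinct (vs @ [(h, \<epsilon>)])"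
          using us vs by (auto simp: traverses_def)
        hence "p \<noteq> (t, \<epsilon>)" "p \<noteq> (h, \<epsilon>)" using p disj us(2) vs(2) by auto
        moreover have "p \<in> pairs_at UNIV" using p us(2) vs(2) by (auto simp: pairs_at_def)
        ultimately show "?f' p = ?f p" by (intro other)
      qed
      moreover have "set (us @ [(t, \<epsilon>)] @ vs @ [(h, \<epsilon>)]) = pairs_at (?A \<union> ?B)"
        using us(2) vs(2) unfolding append_assoc[symmetric] by (auto simp: pairs_at_def)
      ultimately show ?thesis unfolding comp by blast
    next
      case False
      have comp: "{y. same_component (insert \<epsilon> F) x y} = {y. same_component F x y}"
      proof (intro Collect_cong iffI)
        fix y assume "same_component (insert \<epsilon> F) x y"
        from split[OF this] show "same_component F x y"
          using False merge[of x t] same_component_trans[OF merge same_component_sym[OF edge], of x] by auto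
      qed (rule merge)
      obtain xs where xs: "traverses ?f xs" "set xs = pairs_at {y. same_component F x y}"
        using insert.IH[OF F] by meson
      have "traverses ?f' xs"
      proof (rule traverses_cong[OF xs(1)])
        fix p assume p: "p \<in> set xs"
        have "fst p \<noteq> t" "fst p \<noteq> h"
        proof -
          have p: "same_component (insert \<epsilon> F) x (fst p)"
            using p merge unfolding xs(2) pairs_at_def by auto
          show "fst p \<noteq> t" using p False by auto
          show "fst p \<noteq> h" using p False same_component_trans[OF _ same_component_sym[OF edge]] by auto
        qed
        thus "?f' p = ?f p" using p xs(2) by (intro other) (auto simp: pairs_at_def)
      qed
      thus ?thesis using xs(2) unfolding comp by blast
    qed
  qed
qed

lemma tour_eqI: "traverses (tour_step \<rho> T) (b # xs) \<Longrightarrow> tour \<rho> b T = b # xs"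
  unfolding tour_def by (rule traverses_eq_orbit_list)

lemma traverses_tour:
  assumes T: "und_spanning_tree E T"
  shows "traverses (tour_step \<rho> T) (tour \<rho> b T)" "set (tour \<rho> b T) = pairs_at UNIV"
    "hd (tour \<rho> b T) = b"
proof -
  obtain xs where xs: "traverses (tour_step \<rho> T) xs" "set xs = pairs_at {y. same_component T (fst b) y}"
    using traverses_component[of T "fst b"] spanning_treeD[OF T] by blast
  have UNIV: "{y. same_component T (fst b) y} = UNIV" using spanning_treeD(2)[OF T] by auto
  obtain ys where ys: "traverses (tour_step \<rho> T) (b # ys)" "set (b # ys) = pairs_at UNIV"
    using traverses_starting_at[OF xs(1)] basis_pair xs(2) unfolding UNIV by metis
  have "tour \<rho> b T = b # ys" using ys(1) by (rule tour_eqI)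
  thus "traverses (tour_step \<rho> T) (tour \<rho> b T)" "set (tour \<rho> b T) = pairs_at UNIV"
    "hd (tour \<rho> b T) = b" using ys by simp_all
qed

lemma distinct_tour: "und_spanning_tree E T \<Longrightarrow> distinct (tour \<rho> b T)"
  using traverses_tour(1) by (auto simp: traverses_def)

lemma length_tour: "und_spanning_tree E T \<Longrightarrow> length (tour \<rho> b T) = card (pairs_at UNIV)"
  using distinct_card[OF distinct_tour] traverses_tour(2) by simp

lemma tour_nth_0: "und_spanning_tree E T \<Longrightarrow> tour \<rho> b T ! 0 = b"
  using traverses_tour(2,3) basis_pair by (metis empty_iff empty_set hd_conv_nth)

lemma tour_nth_Suc:
  assumes "und_spanning_tree E T" "Suc k < length (tour \<rho> b T)"
  shows "tour \<rho> b T ! Suc k = tour_step \<rho> T (tour \<rho> b T ! k)"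
proof -
  have "map (tour_step \<rho> T) (tour \<rho> b T) ! k = rotate1 (tour \<rho> b T) ! k"
    using traverses_tour(1)[OF assms(1)] by (simp add: traverses_def)
  thus ?thesis using assms(2) by (simp add: nth_rotate1)
qed

text \<open>
  The tour of \<open>T\<close> is obtained by splicing the two cycles of the tour permutation of \<open>T - \<epsilon>\<close> at the
  pairs of \<open>\<epsilon>\<close>, and each of these cycles consists of the pairs on one side.
\<close>

lemma tour_split:
  assumes T: "und_spanning_tree E T" and \<epsilon>: "\<epsilon> \<in> T"
    and xy: "\<epsilon> = (x, y) \<or> \<epsilon> = (y, x)"
    and x: "same_component (T - {\<epsilon>}) (fst b) x"
  obtains us vs ws where "tour \<rho> b T = us @ [(x, \<epsilon>)] @ vs @ [(y, \<epsilon>)] @ ws"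
    "set (vs @ [(y, \<epsilon>)]) = pairs_at {v. same_component (T - {\<epsilon>}) y v}"
    "set (us @ [(x, \<epsilon>)] @ ws) = pairs_at {v. same_component (T - {\<epsilon>}) x v}"
proof -
  let ?F = "T - {\<epsilon>}"
  let ?A = "{v. same_component ?F x v}" and ?B = "{v. same_component ?F y v}"
  let ?f = "tour_step \<rho> ?F" and ?f' = "tour_step \<rho> T"
  have TE: "T \<subseteq> E" by (rule spanning_treeD(1)[OF T])
  have F: "acyclic_edges ?F" "?F \<subseteq> E"
    using acyclic_edges_subset[OF spanning_treeD(3)[OF T]] TE by auto
  have sep: "\<not> same_component ?F x y"
    using spanning_treeD(3)[OF T] \<epsilon> xy same_component_sym[of ?F x y]
    by (auto simp: acyclic_edges_def)
  have neq: "x \<noteq> y" using sep by auto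
  obtain xs ys where xs: "traverses ?f xs" "set xs = pairs_at ?A"
    and ys: "traverses ?f ys" "set ys = pairs_at ?B"
    using traverses_component[OF F] by meson
  have "b \<in> set xs"
    using basis_pair x unfolding xs(2) by (cases b) (auto simp: pairs_at_def dest: same_component_sym)
  then obtain zs where zs: "traverses ?f (b # zs)" "set (b # zs) = pairs_at ?A"
    using traverses_starting_at[OF xs(1)] xs(2) by metis
  have "(x, \<epsilon>) \<in> set (b # zs)" "(y, \<epsilon>) \<in> set ys"
    using \<epsilon> TE xy unfolding zs ys by (auto simp: pairs_at_iff)
  then obtain us ws where uw: "b # zs = us @ (x, \<epsilon>) # ws" by (meson split_list)
  obtain vs where vs: "traverses ?f (vs @ [(y, \<epsilon>)])" "set (vs @ [(y, \<epsilon>)]) = pairs_at ?B"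
    using traverses_ending_at[OF ys(1) \<open>(y, \<epsilon>) \<in> set ys\<close>] ys(2) by metis
  have wu: "traverses ?f ((ws @ us) @ [(x, \<epsilon>)])"
    using traverses_append_commute[of ?f "us @ [(x, \<epsilon>)]" ws] zs(1) unfolding uw by simp
  have set_wu: "set ((ws @ us) @ [(x, \<epsilon>)]) = pairs_at ?A" using zs(2) unfolding uw by auto
  have disj: "pairs_at ?A \<inter> pairs_at ?B = {}"
    using sep by (auto simp: pairs_at_def dest: same_component_sym same_component_trans)
  have "traverses ?f' ((ws @ us) @ [(x, \<epsilon>)] @ vs @ [(y, \<epsilon>)])"
  proof (rule traverses_merge[OF wu vs(1)])
    show "set ((ws @ us) @ [(x, \<epsilon>)]) \<inter> set (vs @ [(y, \<epsilon>)]) = {}" using disj unfolding set_wu vs .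
    show "?f' (x, \<epsilon>) = ?f (y, \<epsilon>)" "?f' (y, \<epsilon>) = ?f (x, \<epsilon>)"
      using \<epsilon> xy neq by (auto simp: tour_step_def other_end_def)
    fix p assume p: "p \<in> set (ws @ us) \<union> set vs"
    have "distinct ((ws @ us) @ [(x, \<epsilon>)])" "distinct (vs @ [(y, \<epsilon>)])"
      using wu vs by (auto simp: traverses_def)
    hence "p \<noteq> (x, \<epsilon>)" "p \<noteq> (y, \<epsilon>)" using p disj set_wu vs(2) by auto
    moreover have "p \<in> pairs_at UNIV" using p set_wu vs(2) by (auto simp: pairs_at_def)
    ultimately have "snd p \<noteq> \<epsilon>" using xy by (cases p) (auto simp: pairs_at_iff)
    thus "?f' p = ?f p" by (cases p) (auto simp: tour_step_def)
  qed
  hence "traverses ?f' (us @ [(x, \<epsilon>)] @ vs @ [(y, \<epsilon>)] @ ws)"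
    using traverses_append_commute[of ?f' ws "us @ [(x, \<epsilon>)] @ vs @ [(y, \<epsilon>)]"] by simp
  moreover obtain zs' where "us @ [(x, \<epsilon>)] @ vs @ [(y, \<epsilon>)] @ ws = b # zs'"
    using uw by (cases us) auto
  ultimately have "tour \<rho> b T = us @ [(x, \<epsilon>)] @ vs @ [(y, \<epsilon>)] @ ws"
    using tour_eqI by simp
  moreover have "set (us @ [(x, \<epsilon>)] @ ws) = pairs_at ?A" using set_wu by auto
  ultimately show thesis using vs(2) by (intro that)
qed

definition base_side :: "'v edge set \<Rightarrow> 'v edge \<Rightarrow> 'v set" where
  "base_side T \<epsilon> = {v. same_component (T - {\<epsilon>}) (fst b) v}"

abbreviation before :: "'v edge set \<Rightarrow> 'v \<times> 'v edge \<Rightarrow> 'v \<times> 'v edge \<Rightarrow> bool" where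
  "before T \<equiv> occurs_before (tour \<rho> b T)"

lemma same_component_iff_base_side:
  assumes "und_spanning_tree E T" "\<epsilon> \<in> T"
  shows "same_component (T - {\<epsilon>}) u v \<longleftrightarrow> (u \<in> base_side T \<epsilon> \<longleftrightarrow> v \<in> base_side T \<epsilon>)"
  unfolding base_side_def mem_Collect_eq same_component_minus_edge_iff[OF assms] by blast

lemma head_side_eq_base_side:
  assumes "und_spanning_tree E T" "\<epsilon> \<in> T"
  shows "head_side T \<epsilon> = (if snd \<epsilon> \<in> base_side T \<epsilon> then base_side T \<epsilon> else - base_side T \<epsilon>)"
  unfolding head_side_def same_component_iff_base_side[OF assms] by auto

lemma base_side_ends:
  assumes "und_spanning_tree E T" "\<epsilon> \<in> T"
  shows "fst \<epsilon> \<in> base_side T \<epsilon> \<longleftrightarrow> snd \<epsilon> \<notin> base_side T \<epsilon>"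
  using head_side_ends[OF assms] head_side_eq_base_side[OF assms] by (auto split: if_splits)

lemma tree_edge_same_side:
  assumes "und_spanning_tree E T" "\<epsilon> \<in> T" "f \<in> T" "f \<noteq> \<epsilon>"
  shows "fst f \<in> base_side T \<epsilon> \<longleftrightarrow> snd f \<in> base_side T \<epsilon>"
  using same_component_edge[of f "T - {\<epsilon>}"] assms same_component_iff_base_side[OF assms(1,2)] by simp

text \<open>
  The far side is toured without interruption: the excursion begins right after the pair of \<open>\<epsilon>\<close> on the
  base side, and a base side pair that precedes any part of it precedes all of it.
\<close>

lemma tour_far_side:
  assumes T: "und_spanning_tree E T" and \<epsilon>: "\<epsilon> \<in> T"
    and x: "x \<in> base_side T \<epsilon>" "x = fst \<epsilon> \<or> x = snd \<epsilon>"
    and far: "(u, e) \<in> pairs_at (- base_side T \<epsilon>)"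
  shows "before T (x, \<epsilon>) (u, e)"
    and "(v, f) \<in> pairs_at (base_side T \<epsilon>) \<Longrightarrow> before T (v, f) (u, e) \<Longrightarrow>
      (v, f) = (x, \<epsilon>) \<or> before T (v, f) (x, \<epsilon>)"
proof -
  define y where "y = other_end x \<epsilon>"
  have xy: "\<epsilon> = (x, y) \<or> \<epsilon> = (y, x)"
    using x(2) unfolding y_def other_end_def by (cases \<epsilon>) auto
  have y: "y \<notin> base_side T \<epsilon>" using base_side_ends[OF T \<epsilon>] x(1) xy by auto
  have sides: "{v. same_component (T - {\<epsilon>}) x v} = base_side T \<epsilon>"
    "{v. same_component (T - {\<epsilon>}) y v} = - base_side T \<epsilon>"
    unfolding same_component_iff_base_side[OF T \<epsilon>] using x y by auto
  have "same_component (T - {\<epsilon>}) (fst b) x" using x(1) by (simp add: base_side_def)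
  then obtain us vs ws where tour: "tour \<rho> b T = us @ [(x, \<epsilon>)] @ vs @ [(y, \<epsilon>)] @ ws"
    and set_vs: "set (vs @ [(y, \<epsilon>)]) = pairs_at (- base_side T \<epsilon>)"
    and set_us: "set (us @ [(x, \<epsilon>)] @ ws) = pairs_at (base_side T \<epsilon>)"
    using tour_split[OF T \<epsilon> xy] unfolding sides by blast
  have ue: "(u, e) \<in> set (vs @ [(y, \<epsilon>)])" using far unfolding set_vs .
  show "before T (x, \<epsilon>) (u, e)"
    using occurs_before_append[of "(x, \<epsilon>)" "us @ [(x, \<epsilon>)]" "(u, e)" "vs @ [(y, \<epsilon>)] @ ws"] ue
    unfolding tour by auto
  assume v: "(v, f) \<in> pairs_at (base_side T \<epsilon>)" "before T (v, f) (u, e)"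
  have "(v, f) \<in> set us \<or> (v, f) = (x, \<epsilon>) \<or> (v, f) \<in> set ws"
    using v(1) unfolding set_us[symmetric] by auto
  thus "(v, f) = (x, \<epsilon>) \<or> before T (v, f) (x, \<epsilon>)"
  proof (elim disjE)
    assume "(v, f) \<in> set us"
    thus ?thesis using occurs_before_append[of "(v, f)" us "(x, \<epsilon>)" "[(x, \<epsilon>)] @ vs @ [(y, \<epsilon>)] @ ws"]
      unfolding tour by simp
  next
    assume "(v, f) \<in> set ws"
    hence "before T (u, e) (v, f)"
      using occurs_before_append[of "(u, e)" "us @ [(x, \<epsilon>)] @ vs @ [(y, \<epsilon>)]" "(v, f)" ws] ue
      unfolding tour by auto
    thus ?thesis using v(2) occurs_before_asym[OF distinct_tour[OF T]] by blast
  qed simp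
qed

section \<open>The first difference of two tours\<close>

text \<open>
  The position of the last pair in the common initial segment of the two tours: the trees treat its
  edge differently, so the tours part right after it.
\<close>

definition first_difference :: "'v edge set \<Rightarrow> 'v edge set \<Rightarrow> nat \<Rightarrow> bool" where
  "first_difference T T' k \<longleftrightarrow> k < card (pairs_at UNIV) \<and>
     (\<forall>j\<le>k. tour \<rho> b T ! j = tour \<rho> b T' ! j) \<and>
     (\<forall>j<k. snd (tour \<rho> b T ! j) \<in> T \<longleftrightarrow> snd (tour \<rho> b T ! j) \<in> T') \<and>
     (snd (tour \<rho> b T ! k) \<in> T) \<noteq> (snd (tour \<rho> b T ! k) \<in> T')"

lemma first_difference_exists:
  assumes T: "und_spanning_tree E T" and T': "und_spanning_tree E T'" and neq: "T \<noteq> T'"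
  obtains k where "first_difference T T' k"
proof -
  let ?t = "tour \<rho> b T" and ?t' = "tour \<rho> b T'"
  let ?D = "\<lambda>k. k < card (pairs_at UNIV) \<and> (snd (?t ! k) \<in> T) \<noteq> (snd (?t ! k) \<in> T')"
  obtain e where e: "(e \<in> T) \<noteq> (e \<in> T')" using neq by blast
  have "(fst e, e) \<in> set ?t"
    unfolding traverses_tour(2)[OF T] using e spanning_treeD(1)[OF T] spanning_treeD(1)[OF T']
    by (auto simp: pairs_at_iff)
  then obtain k0 where "k0 < length ?t" "?t ! k0 = (fst e, e)" by (auto simp: in_set_conv_nth)
  hence "?D k0" using e by (simp add: length_tour[OF T])
  define k where "k = (LEAST k. ?D k)"
  have k: "?D k" unfolding k_def by (rule LeastI) fact
  have least: "snd (?t ! j) \<in> T \<longleftrightarrow> snd (?t ! j) \<in> T'" if "j < k" for j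
    using not_less_Least[of j ?D] that k unfolding k_def[symmetric] by auto
  have "?t ! j = ?t' ! j" if "j \<le> k" for j
    using that
  proof (induction j)
    case 0
    show ?case by (simp add: tour_nth_0 T T')
  next
    case (Suc j)
    have "?t ! Suc j = tour_step \<rho> T (?t ! j)" "?t' ! Suc j = tour_step \<rho> T' (?t' ! j)"
      using Suc.prems k by (auto intro!: tour_nth_Suc T T' simp: length_tour T T')
    moreover have "tour_step \<rho> T (?t ! j) = tour_step \<rho> T' (?t ! j)"
      using least[of j] Suc.prems by (cases "?t ! j") (simp add: tour_step_def)
    ultimately show ?case using Suc by simp
  qed
  thus thesis using that k least unfolding first_difference_def by blast
qed

lemma first_difference_sym: "first_difference T T' k \<Longrightarrow> first_difference T' T k"
  unfolding first_difference_def by auto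

lemma tree_prec_iff:
  assumes T: "und_spanning_tree E T" and T': "und_spanning_tree E T'"
    and k: "first_difference T' T k" and pair: "tour \<rho> b T ! k = (x, \<epsilon>)"
  shows "tree_prec \<rho> b T' T \<longleftrightarrow> x = fst \<epsilon> \<and> \<epsilon> \<notin> T' \<and> \<epsilon> \<in> T \<or> x = snd \<epsilon> \<and> \<epsilon> \<notin> T \<and> \<epsilon> \<in> T'"
proof -
  let ?t = "tour \<rho> b T" and ?t' = "tour \<rho> b T'"
  have k': "k < length ?t" "k < length ?t'" using k by (auto simp: first_difference_def length_tour T T')
  have eq: "?t' ! j = ?t ! j" if "j \<le> k" for j using k that by (auto simp: first_difference_def)
  have diff: "(\<epsilon> \<in> T) \<noteq> (\<epsilon> \<in> T')" using k pair eq[of k] by (auto simp: first_difference_def)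
  have xe: "\<epsilon> \<in> E" "x = fst \<epsilon> \<or> x = snd \<epsilon>"
    using nth_mem[OF k'(1)] unfolding pair traverses_tour(2)[OF T] pairs_at_iff by auto
  \<comment> \<open>only one of the two tours moves on to the other end of \<open>\<epsilon>\<close>\<close>
  have "tour_step \<rho> T (x, \<epsilon>) \<noteq> tour_step \<rho> T' (x, \<epsilon>)"
    using diff no_loop[OF xe(1)] xe(2) by (auto simp: tour_step_def other_end_def split: if_splits)
  hence "?t' ! Suc k \<noteq> ?t ! Suc k" if "Suc k < length ?t'" "Suc k < length ?t"
    using tour_nth_Suc[OF T that(2)] tour_nth_Suc[OF T' that(1)] pair eq[of k] by simp
  hence "last (longest_common_prefix ?t' ?t) = (x, \<epsilon>)"
    using last_longest_common_prefix[OF k'(2,1)] eq pair by auto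
  moreover have "T' \<noteq> T" using diff by auto
  ultimately show ?thesis unfolding tree_prec_def by simp
qed

text \<open>
  The form in which the order \<open>\<prec>\<close> is used: the first difference is the earliest pair in the tour of
  \<open>T\<close> whose edge belongs to exactly one of the trees.
\<close>

lemma first_differenceE:
  assumes T: "und_spanning_tree E T" and T': "und_spanning_tree E T'" and neq: "T' \<noteq> T"
  obtains x \<epsilon> where "(x, \<epsilon>) \<in> pairs_at UNIV" "(\<epsilon> \<in> T) \<noteq> (\<epsilon> \<in> T')"
    "\<And>u e. before T (u, e) (x, \<epsilon>) \<Longrightarrow> e \<in> T \<longleftrightarrow> e \<in> T'"
    "tree_prec \<rho> b T' T \<longleftrightarrow> x = fst \<epsilon> \<and> \<epsilon> \<notin> T' \<and> \<epsilon> \<in> T \<or> x = snd \<epsilon> \<and> \<epsilon> \<notin> T \<and> \<epsilon> \<in> T'"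
proof -
  let ?t = "tour \<rho> b T"
  obtain k where k: "first_difference T' T k" using first_difference_exists[OF T' T neq] by blast
  note k' = first_difference_sym[OF k, unfolded first_difference_def]
  obtain x \<epsilon> where pair: "?t ! k = (x, \<epsilon>)" by (cases "?t ! k")
  have kl: "k < length ?t" using k' by (simp add: length_tour T)
  show thesis
  proof (rule that)
    show "(x, \<epsilon>) \<in> pairs_at UNIV"
      using nth_mem[OF kl] unfolding pair traverses_tour(2)[OF T] .
    show "(\<epsilon> \<in> T) \<noteq> (\<epsilon> \<in> T')" using k' pair by auto
    fix u e assume "before T (u, e) (x, \<epsilon>)"
    then obtain i j where ij: "i < j" "j < length ?t" "?t ! i = (u, e)" "?t ! j = ?t ! k"
      unfolding occurs_before_def pair by auto
    hence "j = k" using nth_eq_iff_index_eq[OF distinct_tour[OF T], of j k] kl by simp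
    thus "e \<in> T \<longleftrightarrow> e \<in> T'" using k' ij by (metis snd_conv)
  qed (rule tree_prec_iff[OF T T' k pair])
qed

lemma tree_prec_irrefl: "\<not> tree_prec \<rho> b T T"
  by (simp add: tree_prec_def)

lemma tree_prec_total:
  assumes T: "und_spanning_tree E T" and T': "und_spanning_tree E T'" and neq: "T' \<noteq> T"
  shows "tree_prec \<rho> b T' T \<or> tree_prec \<rho> b T T'"
proof -
  obtain k where k: "first_difference T' T k" using first_difference_exists[OF T' T neq] by blast
  obtain x \<epsilon> where pair: "tour \<rho> b T ! k = (x, \<epsilon>)" by (cases "tour \<rho> b T ! k")
  have pair': "tour \<rho> b T' ! k = (x, \<epsilon>)" using k pair by (auto simp: first_difference_def)
  have kl: "k < length (tour \<rho> b T)" using k by (simp add: first_difference_def length_tour T)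
  have "x = fst \<epsilon> \<or> x = snd \<epsilon>"
    using nth_mem[OF kl] unfolding pair traverses_tour(2)[OF T] pairs_at_iff by auto
  moreover have "(\<epsilon> \<in> T) \<noteq> (\<epsilon> \<in> T')" using k pair' by (auto simp: first_difference_def)
  ultimately show ?thesis
    unfolding tree_prec_iff[OF T T' k pair] tree_prec_iff[OF T' T first_difference_sym[OF k] pair'] by auto
qed

text \<open>
  As for a lexicographic order, the earlier of the two first differences decides; they cannot
  coincide, because the edge at the first difference would have to be both in and not in \<open>T2\<close>.
\<close>

lemma tree_prec_trans:
  assumes T1: "und_spanning_tree E T1" and T2: "und_spanning_tree E T2" and T3: "und_spanning_tree E T3"
    and 12: "tree_prec \<rho> b T1 T2" and 23: "tree_prec \<rho> b T2 T3"
  shows "tree_prec \<rho> b T1 T3"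
proof -
  obtain k where k: "first_difference T1 T2 k"
    using first_difference_exists[OF T1 T2] 12 by (auto simp: tree_prec_def)
  obtain l where l: "first_difference T2 T3 l"
    using first_difference_exists[OF T2 T3] 23 by (auto simp: tree_prec_def)
  obtain x \<epsilon> where xe: "tour \<rho> b T2 ! k = (x, \<epsilon>)" by (cases "tour \<rho> b T2 ! k")
  obtain y \<delta> where yd: "tour \<rho> b T2 ! l = (y, \<delta>)" by (cases "tour \<rho> b T2 ! l")
  have yd3: "tour \<rho> b T3 ! l = (y, \<delta>)" using l yd by (auto simp: first_difference_def)
  note c12 = 12[unfolded tree_prec_iff[OF T2 T1 k xe]]
  note c23 = 23[unfolded tree_prec_iff[OF T3 T2 l yd3]]
  have \<epsilon>E: "\<epsilon> \<in> E" using c12 spanning_treeD(1)[OF T1] spanning_treeD(1)[OF T2] by auto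
  have k_eq: "tour \<rho> b T1 ! j = tour \<rho> b T2 ! j" if "j \<le> k" for j
    using k that by (simp add: first_difference_def)
  have l_eq: "tour \<rho> b T2 ! j = tour \<rho> b T3 ! j" if "j \<le> l" for j
    using l that by (simp add: first_difference_def)
  have k_agree: "snd (tour \<rho> b T1 ! j) \<in> T1 \<longleftrightarrow> snd (tour \<rho> b T1 ! j) \<in> T2" if "j < k" for j
    using k that unfolding first_difference_def by blast
  have l_agree: "snd (tour \<rho> b T2 ! j) \<in> T2 \<longleftrightarrow> snd (tour \<rho> b T2 ! j) \<in> T3" if "j < l" for j
    using l that unfolding first_difference_def by blast
  have bounds: "k < card (pairs_at UNIV)" "l < card (pairs_at UNIV)"
    using k l by (simp_all add: first_difference_def)
  have differ: "(\<epsilon> \<in> T1) \<noteq> (\<epsilon> \<in> T2)" "(\<delta> \<in> T2) \<noteq> (\<delta> \<in> T3)"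
    using k l k_eq[of k] xe yd by (simp_all add: first_difference_def)
  consider "k < l" | "l < k" | "k = l" by linarith
  thus ?thesis
  proof cases
    case 1
    have "first_difference T1 T3 k"
      unfolding first_difference_def
    proof (intro conjI allI impI)
      fix j assume "j \<le> k"
      thus "tour \<rho> b T1 ! j = tour \<rho> b T3 ! j" using k_eq[of j] l_eq[of j] 1 by simp
    next
      fix j assume "j < k"
      thus "snd (tour \<rho> b T1 ! j) \<in> T1 \<longleftrightarrow> snd (tour \<rho> b T1 ! j) \<in> T3"
        using k_eq[of j] k_agree[of j] l_agree[of j] 1 by simp
    next
      show "(snd (tour \<rho> b T1 ! k) \<in> T1) \<noteq> (snd (tour \<rho> b T1 ! k) \<in> T3)"
        using differ(1) l_agree[OF 1] k_eq[of k] xe by simp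
    qed (rule bounds)
    moreover have "tour \<rho> b T3 ! k = (x, \<epsilon>)"
      using l_eq[of k] 1 xe by simp
    moreover have "\<epsilon> \<in> T2 \<longleftrightarrow> \<epsilon> \<in> T3"
      using l_agree[OF 1, unfolded xe] by simp
    ultimately show ?thesis using c12 tree_prec_iff[OF T3 T1] by simp
  next
    case 2
    have "first_difference T1 T3 l"
      unfolding first_difference_def
    proof (intro conjI allI impI)
      fix j assume "j \<le> l"
      thus "tour \<rho> b T1 ! j = tour \<rho> b T3 ! j" using k_eq[of j] l_eq[of j] 2 by simp
    next
      fix j assume "j < l"
      thus "snd (tour \<rho> b T1 ! j) \<in> T1 \<longleftrightarrow> snd (tour \<rho> b T1 ! j) \<in> T3"
        using k_eq[of j] k_agree[of j] l_agree[of j] 2 by simp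
    next
      show "(snd (tour \<rho> b T1 ! l) \<in> T1) \<noteq> (snd (tour \<rho> b T1 ! l) \<in> T3)"
        using differ(2) k_agree[OF 2] k_eq[of l] 2 yd by simp
    qed (rule bounds)
    moreover have "tour \<rho> b T3 ! l = (y, \<delta>)" "\<delta> \<in> T1 \<longleftrightarrow> \<delta> \<in> T2"
      using yd3 k_eq[of l] k_agree[OF 2] 2 yd by simp_all
    ultimately show ?thesis using c23 tree_prec_iff[OF T3 T1] by simp
  next
    case 3
    hence "y = x" "\<delta> = \<epsilon>" using xe yd by auto
    thus ?thesis using c12 c23 no_loop[OF \<epsilon>E] by auto
  qed
qed

abbreviation jaeger :: "'v edge set \<Rightarrow> bool" where
  "jaeger \<equiv> jaeger_tree E \<rho> b"

text \<open>This is the order \<open>\<prec>\<close>; that symbol already denotes the comparison of cardinalities.\<close>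

abbreviation prec :: "'v edge set \<Rightarrow> 'v edge set \<Rightarrow> bool" (infix \<open>\<sqsubset>\<close> 50) where
  "T' \<sqsubset> T \<equiv> tree_prec \<rho> b T' T"

section \<open>Replaceable edges\<close>

text \<open>
  The edge \<open>\<epsilon>\<close> points away from the base vertex, and some edge of its fundamental cut points back.
  Exchanging \<open>\<epsilon>\<close> for such an edge is what makes the opposite facet visible from smaller trees.
\<close>

definition replaceable :: "'v edge set \<Rightarrow> 'v edge \<Rightarrow> bool" where
  "replaceable T \<epsilon> \<longleftrightarrow> \<epsilon> \<in> T \<and> fst \<epsilon> \<in> base_side T \<epsilon> \<and>
     (\<exists>f\<in>E. fst f \<notin> base_side T \<epsilon> \<and> snd f \<in> base_side T \<epsilon>)"

lemma jaegerD:
  assumes "jaeger T"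
  shows "und_spanning_tree E T" "e \<in> E \<Longrightarrow> e \<notin> T \<Longrightarrow> before T (fst e, e) (snd e, e)"
  using assms by (auto simp: jaeger_tree_def)

lemma fundamental_cut_eq:
  assumes "und_spanning_tree E T" "\<epsilon> \<in> T"
  shows "fundamental_cut E T \<epsilon> = {f \<in> E. (fst f \<in> base_side T \<epsilon>) \<noteq> (snd f \<in> base_side T \<epsilon>)}"
  unfolding fundamental_cut_def same_component_iff_base_side[OF assms] by auto

text \<open>
  The tour of a Jaeger tree meets \<open>f\<close> at its tail, on the base side, before it meets \<open>f\<close> at its head, on
  the far side. So the tail is toured before the only excursion to the far side, which starts at \<open>\<epsilon>\<close>.
\<close>

lemma jaeger_outgoing_cut_edge:
  assumes J: "jaeger T" and \<epsilon>: "\<epsilon> \<in> T" and x: "x \<in> base_side T \<epsilon>" "x = fst \<epsilon> \<or> x = snd \<epsilon>"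
    and f: "f \<in> E" "f \<noteq> \<epsilon>" "fst f \<in> base_side T \<epsilon>" "snd f \<notin> base_side T \<epsilon>"
  shows "f \<notin> T" "before T (fst f, f) (x, \<epsilon>)"
proof -
  note T = jaegerD(1)[OF J]
  show "f \<notin> T" using tree_edge_same_side[OF T \<epsilon>] f by blast
  hence "before T (fst f, f) (snd f, f)" using jaegerD(2)[OF J] f(1) by blast
  thus "before T (fst f, f) (x, \<epsilon>)"
    using tour_far_side(2)[OF T \<epsilon> x, of "snd f" f "fst f" f] f by (auto simp: pairs_at_iff)
qed

text \<open>
  If \<open>\<epsilon>\<close> points away from the base, the cut edges leaving the base side have their tails toured no
  later than the tail of \<open>\<epsilon>\<close>, the returning ones later; so the largest cut edge is a returning one as
  soon as there is any. If \<open>\<epsilon>\<close> points towards the base, its own tail is toured after the tails of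
  all cut edges that leave the base side, so the largest cut edge has its tail on the same side as \<open>\<epsilon>\<close>.
\<close>

lemma semi_passive_iff_replaceable:
  assumes J: "jaeger T"
  shows "internally_semi_passive E (tour_less \<rho> b T) T \<epsilon> \<longleftrightarrow> replaceable T \<epsilon>"
proof (cases "\<epsilon> \<in> T")
  case \<epsilon>: True
  note T = jaegerD(1)[OF J]
  let ?A = "base_side T \<epsilon>" and ?C = "fundamental_cut E T \<epsilon>"
  have \<epsilon>E: "\<epsilon> \<in> E" using spanning_treeD(1)[OF T] \<epsilon> by blast
  have C: "?C = {f \<in> E. (fst f \<in> ?A) \<noteq> (snd f \<in> ?A)}" by (rule fundamental_cut_eq[OF T \<epsilon>])
  have far: "before T (x, \<epsilon>) (fst f, f)"
    if "x \<in> ?A" "x = fst \<epsilon> \<or> x = snd \<epsilon>" "f \<in> E" "fst f \<notin> ?A" for x f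
    using tour_far_side(1)[OF T \<epsilon> that(1,2), of "fst f" f] that by (auto simp: pairs_at_iff)
  note irr = occurs_before_irrefl[OF distinct_tour[OF T]]
  note trans = occurs_before_trans[OF distinct_tour[OF T]]
  note asy = occurs_before_asym[OF distinct_tour[OF T]]
  show ?thesis
  proof
    assume "internally_semi_passive E (tour_less \<rho> b T) T \<epsilon>"
    then obtain g where g: "g \<in> ?C" "\<And>f. f \<in> ?C \<Longrightarrow> f \<noteq> g \<Longrightarrow> before T (fst f, f) (fst g, g)"
      "(fst \<epsilon> \<in> ?A) \<noteq> (fst g \<in> ?A)"
      unfolding internally_semi_passive_def tour_less_def same_component_iff_base_side[OF T \<epsilon>] by blast
    show "replaceable T \<epsilon>"
    proof (cases "fst \<epsilon> \<in> ?A")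
      case True
      thus ?thesis using g \<epsilon> unfolding replaceable_def C by auto
    next
      case False
      hence x: "snd \<epsilon> \<in> ?A" using base_side_ends[OF T \<epsilon>] by blast
      have g': "g \<noteq> \<epsilon>" "fst g \<in> ?A" "snd g \<notin> ?A" "g \<in> E" using g(1,3) False unfolding C by auto
      have "before T (fst \<epsilon>, \<epsilon>) (fst g, g)"
        using g(2)[of \<epsilon>] g'(1) \<epsilon>E False x unfolding C by auto
      also have "before T (fst g, g) (snd \<epsilon>, \<epsilon>)"
        using jaeger_outgoing_cut_edge(2)[OF J \<epsilon> x] g' by blast
      finally (trans) have "before T (fst \<epsilon>, \<epsilon>) (snd \<epsilon>, \<epsilon>)" .
      thus ?thesis using far[OF x _ \<epsilon>E False] asy by blast
    qed
  next
    assume r: "replaceable T \<epsilon>"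
    then obtain f where f: "f \<in> E" "fst f \<notin> ?A" "snd f \<in> ?A" and x: "fst \<epsilon> \<in> ?A"
      by (auto simp: replaceable_def)
    have "\<exists>g\<in>?C. \<forall>f\<in>?C. f \<noteq> g \<longrightarrow> tour_less \<rho> b T f g"
    proof (rule Finite_Set.bex_greatest_element)
      show "transp_on ?C (tour_less \<rho> b T)"
        unfolding tour_less_def by (rule transp_onI) (rule trans)
      show "totalp_on ?C (tour_less \<rho> b T)"
        unfolding tour_less_def
        by (rule totalp_onI, rule occurs_before_total)
          (auto simp: traverses_tour(2)[OF T] pairs_at_iff C)
      show "?C \<noteq> {}" using f unfolding C by blast
    qed simp
    then obtain g where g: "g \<in> ?C" "\<And>f. f \<in> ?C \<Longrightarrow> f \<noteq> g \<Longrightarrow> tour_less \<rho> b T f g" by blast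
    have "fst g \<notin> ?A"
    proof
      assume gA: "fst g \<in> ?A"
      hence "before T (fst f, f) (fst g, g)" using g(2)[of f] f unfolding C tour_less_def by auto
      moreover have "(fst g, g) = (fst \<epsilon>, \<epsilon>) \<or> before T (fst g, g) (fst \<epsilon>, \<epsilon>)"
        using jaeger_outgoing_cut_edge(2)[OF J \<epsilon> x, of g] g(1) gA unfolding C by auto
      ultimately have "before T (fst f, f) (fst \<epsilon>, \<epsilon>)" using trans by metis
      thus False using far[OF x _ f(1,2)] asy by blast
    qed
    thus "internally_semi_passive E (tour_less \<rho> b T) T \<epsilon>"
      unfolding internally_semi_passive_def same_component_iff_base_side[OF T \<epsilon>]
      using \<epsilon> g x by blast
  qed
qed (simp add: internally_semi_passive_def replaceable_def)

text \<open>
  A first difference at a head is impossible: if the edge is missing from \<open>T\<close> then the Jaeger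
  condition makes its tail come earlier. Edges leaving the base side other than \<open>\<epsilon>\<close> are skipped by
  the tour of \<open>T\<close> before the first difference, hence they are missing from \<open>T'\<close> as well; but \<open>T'\<close> has to
  cross the cut somewhere.
\<close>

lemma jaeger_first_difference:
  assumes J: "jaeger T" and J': "jaeger T'" and prec: "T' \<sqsubset> T"
  obtains \<epsilon> where "replaceable T \<epsilon>"
    "\<And>f. f \<in> T' \<Longrightarrow> fst f \<in> base_side T \<epsilon> \<Longrightarrow> snd f \<in> base_side T \<epsilon>"
proof -
  note T = jaegerD(1)[OF J] and T' = jaegerD(1)[OF J']
  have "T' \<noteq> T" using prec tree_prec_irrefl by blast
  then obtain x \<epsilon> where xe: "(x, \<epsilon>) \<in> pairs_at UNIV" "(\<epsilon> \<in> T) \<noteq> (\<epsilon> \<in> T')"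
    and agree: "\<And>u e. before T (u, e) (x, \<epsilon>) \<Longrightarrow> e \<in> T \<longleftrightarrow> e \<in> T'"
    and cond: "x = fst \<epsilon> \<and> \<epsilon> \<notin> T' \<and> \<epsilon> \<in> T \<or> x = snd \<epsilon> \<and> \<epsilon> \<notin> T \<and> \<epsilon> \<in> T'"
    using prec by (metis first_differenceE[OF T T'])
  have \<epsilon>E: "\<epsilon> \<in> E" using xe(1) by (simp add: pairs_at_iff)
  have "\<not> (x = snd \<epsilon> \<and> \<epsilon> \<notin> T)"
    using jaegerD(2)[OF J \<epsilon>E] agree[of "fst \<epsilon>" \<epsilon>] xe(2) by auto
  hence x: "x = fst \<epsilon>" "\<epsilon> \<in> T" "\<epsilon> \<notin> T'" using cond by auto
  let ?A = "base_side T \<epsilon>"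
  have A: "fst \<epsilon> \<in> ?A"
  proof (rule ccontr)
    assume no: "fst \<epsilon> \<notin> ?A"
    hence "before T (snd \<epsilon>, \<epsilon>) (fst \<epsilon>, \<epsilon>)"
      using tour_far_side(1)[OF T x(2), of "snd \<epsilon>" "fst \<epsilon>" \<epsilon>] base_side_ends[OF T x(2)] \<epsilon>E
      by (auto simp: pairs_at_iff)
    thus False using agree xe(2) unfolding x(1) by blast
  qed
  have out: "snd f \<in> ?A" if f: "f \<in> T'" "fst f \<in> ?A" for f
  proof (rule ccontr)
    assume "snd f \<notin> ?A"
    moreover have "f \<in> E" "f \<noteq> \<epsilon>" using f(1) x(3) spanning_treeD(1)[OF T'] by auto
    ultimately have "f \<notin> T" "before T (fst f, f) (fst \<epsilon>, \<epsilon>)"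
      using jaeger_outgoing_cut_edge[OF J x(2) A] f(2) by blast+
    thus False using agree f(1) unfolding x(1) by blast
  qed
  have "\<exists>f\<in>T'. fst f \<notin> ?A \<and> snd f \<in> ?A"
  proof (rule ccontr)
    assume no: "\<not> ?thesis"
    have "v \<in> ?A" if "same_component T' (fst \<epsilon>) v" for v
      using that
    proof (induction rule: same_component_induct)
      case base show ?case by (rule A)
    next
      case (step e u v)
      thus ?case using out[of e] no by auto
    qed
    hence "snd \<epsilon> \<in> ?A" using spanning_treeD(2)[OF T'] by blast
    thus False using A base_side_ends[OF T x(2)] by blast
  qed
  hence "replaceable T \<epsilon>"
    using x(2) A spanning_treeD(1)[OF T'] unfolding replaceable_def by blast
  thus thesis using out by (rule that)
qed

text \<open>
  The functional of the fundamental cut of \<open>\<epsilon>\<close> is nonnegative on one simplex and nonpositive on the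
  other.
\<close>

lemma jaeger_intersection:
  assumes J: "jaeger T" and J': "jaeger T'" and prec: "T' \<sqsubset> T"
  obtains \<epsilon> where "replaceable T \<epsilon>" "root_polytope T \<inter> root_polytope T' \<subseteq> root_polytope (T - {\<epsilon>})"
proof -
  note T = jaegerD(1)[OF J] and T' = jaegerD(1)[OF J']
  obtain \<epsilon> where \<epsilon>: "replaceable T \<epsilon>"
    and out: "\<And>f. f \<in> T' \<Longrightarrow> fst f \<in> base_side T \<epsilon> \<Longrightarrow> snd f \<in> base_side T \<epsilon>"
    using jaeger_first_difference[OF J J' prec] by blast
  have \<epsilon>T: "\<epsilon> \<in> T" and A: "fst \<epsilon> \<in> base_side T \<epsilon>" using \<epsilon> by (auto simp: replaceable_def)
  let ?B = "head_side T \<epsilon>"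
  have B: "?B = - base_side T \<epsilon>"
    using head_side_eq_base_side[OF T \<epsilon>T] base_side_ends[OF T \<epsilon>T] A by simp
  have "p \<in> root_polytope (T - {\<epsilon>})" if p: "p \<in> root_polytope T" "p \<in> root_polytope T'" for p
  proof -
    obtain c where c: "\<And>f. f \<in> T' \<Longrightarrow> 0 \<le> c f" "p = (\<Sum>f\<in>T'. c f *\<^sub>R edge_vec f)"
      using p(2) root_polytope_iff[OF forest_independent(1)[OF spanning_treeD(3)[OF T']]] by blast
    have "cut_form ?B p = (\<Sum>f\<in>T'. c f * cut_form ?B (edge_vec f))"
      unfolding c(2) by (simp add: linear_sum[OF linear_cut_form] linear_scale[OF linear_cut_form])
    also have "\<dots> \<le> 0"
    proof (rule sum_nonpos)
      fix f assume f: "f \<in> T'"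
      have "cut_form ?B (edge_vec f) \<le> 0" using out[OF f] by (auto simp: cut_form_edge_vec B)
      thus "c f * cut_form ?B (edge_vec f) \<le> 0" using c(1)[OF f] by (rule mult_nonneg_nonpos[rotated])
    qed
    finally have "cut_form ?B p = 0"
      using root_polytope_forest(1)[OF spanning_treeD(3)[OF T] \<epsilon>T p(1)] by simp
    thus ?thesis using root_polytope_forest(2)[OF spanning_treeD(3)[OF T] \<epsilon>T p(1)] by blast
  qed
  thus thesis using that[OF \<epsilon>] by blast
qed

text \<open>
  Until the tail of \<open>\<epsilon>\<close> is met, the tour stays on the base side, where the new edge \<open>f\<close> has its head.
  So the first difference is either \<open>\<epsilon>\<close> at its tail or \<open>f\<close> at its head, and both make the new tree
  smaller.
\<close>

lemma replaceable_exchange: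
  assumes T: "und_spanning_tree E T" and r: "replaceable T \<epsilon>"
  obtains T0 where "und_spanning_tree E T0" "T - {\<epsilon>} \<subseteq> T0" "T0 \<sqsubset> T"
proof -
  let ?A = "base_side T \<epsilon>"
  obtain f where f: "f \<in> E" "fst f \<notin> ?A" "snd f \<in> ?A" and \<epsilon>: "\<epsilon> \<in> T" "fst \<epsilon> \<in> ?A"
    using r by (auto simp: replaceable_def)
  define T0 where "T0 = insert f (T - {\<epsilon>})"
  have neq: "f \<noteq> \<epsilon>" using f \<epsilon> by auto
  have fT: "f \<notin> T" using tree_edge_same_side[OF T \<epsilon>(1)] f neq by blast
  have T0: "und_spanning_tree E T0"
    unfolding T0_def
    by (rule exchange_spanning_tree[OF T \<epsilon>(1) f(1)])
      (use f in \<open>simp add: head_side_eq_base_side[OF T \<epsilon>(1)]\<close>)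
  have "T0 \<noteq> T" using fT by (auto simp: T0_def)
  then obtain x g where xg: "(x, g) \<in> pairs_at UNIV" "(g \<in> T) \<noteq> (g \<in> T0)"
    and agree: "\<And>u e. before T (u, e) (x, g) \<Longrightarrow> e \<in> T \<longleftrightarrow> e \<in> T0"
    and prec: "T0 \<sqsubset> T \<longleftrightarrow> x = fst g \<and> g \<notin> T0 \<and> g \<in> T \<or> x = snd g \<and> g \<notin> T \<and> g \<in> T0"
    using first_differenceE[OF T T0] by blast
  have differ: "(e \<in> T) \<noteq> (e \<in> T0) \<longleftrightarrow> e = \<epsilon> \<or> e = f" for e
    using neq fT \<epsilon>(1) by (auto simp: T0_def)
  have not_before: "\<not> before T (fst \<epsilon>, \<epsilon>) (x, g)" using agree differ by blast
  have "x \<in> ?A"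
  proof (rule ccontr)
    assume "x \<notin> ?A"
    hence "before T (fst \<epsilon>, \<epsilon>) (x, g)"
      using tour_far_side(1)[OF T \<epsilon>(1) \<epsilon>(2), of x g] xg(1) by (auto simp: pairs_at_iff)
    thus False using not_before by blast
  qed
  moreover have "g = \<epsilon> \<or> g = f" using xg(2) differ by blast
  moreover have "\<epsilon> \<notin> T0" "f \<in> T0" using neq by (auto simp: T0_def)
  ultimately have "T0 \<sqsubset> T"
    using xg(1) f \<epsilon> neq fT base_side_ends[OF T \<epsilon>(1)] unfolding prec pairs_at_iff by auto
  thus thesis using that[OF T0] by (auto simp: T0_def)
qed

text \<open>
  The tree edge \<open>f\<close> that leaves separates the head of \<open>e\<close>, which the tour meets first, from its tail,
  with the head of \<open>f\<close> on the side of the head of \<open>e\<close>. So the first difference is \<open>e\<close> at its head or \<open>f\<close> at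
  its tail: if \<open>f\<close> is met first at its head, then the head of \<open>e\<close> lies on the base side and \<open>e\<close> is
  met there before the tour crosses \<open>f\<close>.
\<close>

lemma non_jaeger_push:
  assumes T: "und_spanning_tree E T" and nJ: "\<not> jaeger T" and p: "p \<in> root_polytope T"
  obtains T0 where "und_spanning_tree E T0" "p \<in> root_polytope T0" "T0 \<sqsubset> T"
proof -
  obtain e where e: "e \<in> E - T" "\<not> before T (fst e, e) (snd e, e)"
    using T nJ by (auto simp: jaeger_tree_def)
  have eE: "e \<in> E" using e by blast
  have wrong: "before T (snd e, e) (fst e, e)"
    using occurs_before_total[of "(fst e, e)" "tour \<rho> b T" "(snd e, e)"] e no_loop[OF eE]
    by (auto simp: traverses_tour(2)[OF T] pairs_at_iff)
  obtain f where f: "f \<in> T" "snd e \<in> head_side T f" "fst e \<notin> head_side T f"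
    and p0: "p \<in> root_polytope (insert e (T - {f}))"
    using push_along_edge[OF T p e(1)] by blast
  define T0 where "T0 = insert e (T - {f})"
  have neq: "e \<noteq> f" using e f by auto
  have T0: "und_spanning_tree E T0"
    unfolding T0_def by (rule exchange_spanning_tree[OF T f(1) eE]) (use f in blast)
  have "T0 \<noteq> T" using e by (auto simp: T0_def)
  then obtain x g where xg: "(x, g) \<in> pairs_at UNIV" "(g \<in> T) \<noteq> (g \<in> T0)"
    and agree: "\<And>u e. before T (u, e) (x, g) \<Longrightarrow> e \<in> T \<longleftrightarrow> e \<in> T0"
    and prec: "T0 \<sqsubset> T \<longleftrightarrow> x = fst g \<and> g \<notin> T0 \<and> g \<in> T \<or> x = snd g \<and> g \<notin> T \<and> g \<in> T0"
    using first_differenceE[OF T T0] by blast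
  have differ: "(h \<in> T) \<noteq> (h \<in> T0) \<longleftrightarrow> h = e \<or> h = f" for h
    using neq f(1) e(1) by (auto simp: T0_def)
  have g: "g = e \<or> g = f" using xg(2) differ by blast
  have gx: "x = fst g \<or> x = snd g" using xg(1) by (simp add: pairs_at_iff)
  have "T0 \<sqsubset> T"
  proof (cases "g = e")
    case True
    have "x \<noteq> fst e" using agree[of "snd e" e] wrong differ[of e] True by blast
    thus ?thesis using prec gx True e(1) by (auto simp: T0_def)
  next
    case False
    hence gf: "g = f" using g by blast
    have "x \<noteq> snd f"
    proof
      assume x: "x = snd f"
      let ?A = "base_side T f"
      have fE: "f \<in> E" using f(1) spanning_treeD(1)[OF T] by blast
      have sndA: "snd f \<in> ?A"
      proof (rule ccontr)
        assume no: "snd f \<notin> ?A"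
        hence "before T (fst f, f) (snd f, f)"
          using tour_far_side(1)[OF T f(1), of "fst f" "snd f" f] base_side_ends[OF T f(1)] fE
          by (auto simp: pairs_at_iff)
        thus False using agree[of "fst f" f] differ[of f] gf x by blast
      qed
      hence "snd e \<in> ?A" "fst e \<notin> ?A" using f head_side_eq_base_side[OF T f(1)] by auto
      hence "(snd e, e) = (snd f, f) \<or> before T (snd e, e) (snd f, f)"
        using tour_far_side(2)[OF T f(1) sndA, of "fst e" e "snd e" e] wrong eE by (auto simp: pairs_at_iff)
      thus False using neq agree[of "snd e" e] differ[of e] gf x by blast
    qed
    thus ?thesis using prec gx gf f(1) neq by (auto simp: T0_def)
  qed
  thus thesis using that[OF T0] p0 by (simp add: T0_def)
qed

text \<open>
  Among the spanning trees up to \<open>T\<close> whose simplex contains the point, the \<open>\<prec>\<close>-smallest one is a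
  Jaeger tree, since otherwise an exchange would lead to a smaller one.
\<close>

lemma jaeger_tree_below:
  assumes T: "und_spanning_tree E T" and p: "p \<in> root_polytope T"
  obtains T' where "jaeger T'" "p \<in> root_polytope T'" "T' = T \<or> T' \<sqsubset> T"
proof -
  define \<T> where "\<T> = {T'. und_spanning_tree E T' \<and> p \<in> root_polytope T' \<and> (T' = T \<or> T' \<sqsubset> T)}"
  have "\<exists>m\<in>\<T>. \<forall>T'\<in>\<T>. T' \<noteq> m \<longrightarrow> m \<sqsubset> T'"
  proof (rule Finite_Set.bex_least_element)
    show "transp_on \<T> (\<sqsubset>)"
      by (rule transp_onI) (auto simp: \<T>_def intro: tree_prec_trans)
    show "totalp_on \<T> (\<sqsubset>)"
      by (rule totalp_onI) (auto simp: \<T>_def dest: tree_prec_total)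
    show "\<T> \<noteq> {}" using T p by (auto simp: \<T>_def)
  qed simp
  then obtain m where m: "m \<in> \<T>" "\<And>T'. T' \<in> \<T> \<Longrightarrow> T' \<noteq> m \<Longrightarrow> m \<sqsubset> T'" by blast
  have mT: "und_spanning_tree E m" "p \<in> root_polytope m" "m = T \<or> m \<sqsubset> T" using m(1) by (auto simp: \<T>_def)
  have "jaeger m"
  proof (rule ccontr)
    assume "\<not> jaeger m"
    then obtain T0 where T0: "und_spanning_tree E T0" "p \<in> root_polytope T0" "T0 \<sqsubset> m"
      using non_jaeger_push[OF mT(1) _ mT(2)] by blast
    hence "T0 \<sqsubset> T" using mT tree_prec_trans[OF T0(1) mT(1) T] by blast
    hence "T0 \<in> \<T>" using T0 by (simp add: \<T>_def)
    hence "m \<sqsubset> m" using m(2)[of T0] T0 tree_prec_irrefl tree_prec_trans[OF mT(1) T0(1) mT(1)] by blast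
    thus False using tree_prec_irrefl by blast
  qed
  thus thesis using that mT by blast
qed

section \<open>Facets shared with earlier simplices\<close>

definition earlier :: "'v edge set \<Rightarrow> (real ^ 'v) set" where
  "earlier T = (\<Union>T'\<in>{T'. jaeger T' \<and> T' \<sqsubset> T}. root_polytope T')"

text \<open>
  Each predecessor meets the simplex inside a facet opposite to a replaceable edge. A point of such a
  facet lies in the simplex of the smaller tree obtained by exchange, and from there it descends
  to a Jaeger tree.
\<close>

lemma intersection_with_earlier:
  assumes J: "jaeger T"
  shows "root_polytope T \<inter> earlier T = (\<Union>\<epsilon>\<in>{\<epsilon>. replaceable T \<epsilon>}. root_polytope (T - {\<epsilon>}))"
proof (intro equalityI subsetI)
  fix p assume "p \<in> root_polytope T \<inter> earlier T"
  then obtain T' where T': "jaeger T'" "T' \<sqsubset> T" and p: "p \<in> root_polytope T \<inter> root_polytope T'"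
    by (auto simp: earlier_def)
  obtain \<epsilon> where "replaceable T \<epsilon>" "root_polytope T \<inter> root_polytope T' \<subseteq> root_polytope (T - {\<epsilon>})"
    using jaeger_intersection[OF J T'] by blast
  hence "replaceable T \<epsilon>" "p \<in> root_polytope (T - {\<epsilon>})" using p by auto
  thus "p \<in> (\<Union>\<epsilon>\<in>{\<epsilon>. replaceable T \<epsilon>}. root_polytope (T - {\<epsilon>}))" by blast
next
  note T = jaegerD(1)[OF J]
  fix p assume "p \<in> (\<Union>\<epsilon>\<in>{\<epsilon>. replaceable T \<epsilon>}. root_polytope (T - {\<epsilon>}))"
  then obtain \<epsilon> where \<epsilon>: "replaceable T \<epsilon>" "p \<in> root_polytope (T - {\<epsilon>})" by blast
  obtain T0 where T0: "und_spanning_tree E T0" "T - {\<epsilon>} \<subseteq> T0" "T0 \<sqsubset> T"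
    using replaceable_exchange[OF T \<epsilon>(1)] by blast
  have "p \<in> root_polytope T0" using \<epsilon>(2) root_polytope_mono[OF T0(2)] by blast
  then obtain T' where T': "jaeger T'" "p \<in> root_polytope T'" "T' = T0 \<or> T' \<sqsubset> T0"
    using jaeger_tree_below[OF T0(1)] by blast
  hence "T' \<sqsubset> T" using T0 tree_prec_trans[OF jaegerD(1)[OF T'(1)] T0(1) T] by blast
  moreover have "p \<in> root_polytope T" using \<epsilon>(2) root_polytope_mono[of "T - {\<epsilon>}" T] by blast
  ultimately show "p \<in> root_polytope T \<inter> earlier T" using T' by (auto simp: earlier_def)
qed

text \<open>
  If \<open>\<epsilon>\<close> were the only edge, a returning cut edge would have edge vector \<open>- edge_vec \<epsilon>\<close>, which
  contradicts the height.
\<close>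

lemma replaceable_card_ge_2:
  assumes T: "und_spanning_tree E T" and r: "replaceable T \<epsilon>"
  shows "2 \<le> card T"
proof (rule ccontr)
  assume "\<not> 2 \<le> card T"
  moreover have \<epsilon>: "\<epsilon> \<in> T" using r by (simp add: replaceable_def)
  moreover have "finite T" by simp
  ultimately have "card T = 1" by (cases "card T") auto
  hence T_eq: "T = {\<epsilon>}" using \<epsilon> by (auto simp: card_1_singleton_iff)
  obtain f where f: "f \<in> E" "fst f \<notin> base_side T \<epsilon>" "snd f \<in> base_side T \<epsilon>" "fst \<epsilon> \<in> base_side T \<epsilon>"
    using r by (auto simp: replaceable_def)
  have "head_side T \<epsilon> = - base_side T \<epsilon>"
    using head_side_eq_base_side[OF T \<epsilon>] base_side_ends[OF T \<epsilon>] f(4) by simp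
  hence "cut_form (head_side T \<epsilon>) (edge_vec f) = -1" using f by (simp add: cut_form_edge_vec)
  moreover have "edge_vec f = (\<Sum>g\<in>T. cut_form (head_side T g) (edge_vec f) *\<^sub>R edge_vec g)"
    by (rule edge_vec_expansion) (use spanning_treeD[OF T] in auto)
  hence "(\<Sum>g\<in>T. cut_form (head_side T g) (edge_vec f)) = (\<Sum>g\<in>{f}. 1)"
    by (intro sum_coefficients) (use spanning_treeD(1)[OF T] f(1) in auto)
  ultimately show False by (simp add: T_eq)
qed

lemma vertex_not_in_opposite_facet:
  assumes T: "und_spanning_tree E T" and \<epsilon>: "\<epsilon> \<in> T"
  shows "edge_vec \<epsilon> \<in> root_polytope T" "edge_vec \<epsilon> \<notin> root_polytope (T - {\<epsilon>})"
proof -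
  show 1: "edge_vec \<epsilon> \<in> root_polytope T"
    unfolding root_polytope_eq by (rule hull_inc) (use \<epsilon> in blast)
  note ac = spanning_treeD(3)[OF T]
  show "edge_vec \<epsilon> \<notin> root_polytope (T - {\<epsilon>})"
    unfolding root_polytope_forest(2)[OF ac \<epsilon> 1] cut_form_forest[OF ac \<epsilon> \<epsilon>] by simp
qed

text \<open>
  The barycenter of the facet has a positive coordinate at every edge except \<open>\<epsilon>\<close>.
\<close>

lemma facet_has_private_point:
  assumes T: "und_spanning_tree E T" and \<epsilon>: "\<epsilon> \<in> T" and card: "2 \<le> card T"
  obtains p where "p \<in> root_polytope (T - {\<epsilon>})"
    "\<And>f. f \<in> T \<Longrightarrow> p \<in> root_polytope (T - {f}) \<Longrightarrow> f = \<epsilon>"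
proof -
  note ac = spanning_treeD(3)[OF T]
  have inj: "inj_on edge_vec (T - {\<epsilon>})"
    using forest_independent(1)[OF ac] by (rule inj_on_diff)
  define n where "n = real (card (T - {\<epsilon>}))"
  have n: "n > 0" using card \<epsilon> by (simp add: n_def)
  define p where "p = (\<Sum>f\<in>T - {\<epsilon>}. (1 / n) *\<^sub>R edge_vec f)"
  have p: "p \<in> root_polytope (T - {\<epsilon>})"
    unfolding root_polytope_iff[OF inj] p_def
    by (rule exI[of _ "\<lambda>_. 1 / n"]) (use n in \<open>simp add: n_def[symmetric] del: card_Diff_insert\<close>)
  hence pT: "p \<in> root_polytope T" using root_polytope_mono[of "T - {\<epsilon>}" T] by blast
  have p': "p = (\<Sum>f\<in>T. (if f = \<epsilon> then 0 else 1 / n) *\<^sub>R edge_vec f)"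
    unfolding p_def by (rule sum.mono_neutral_cong_left) auto
  have "f = \<epsilon>" if f: "f \<in> T" "p \<in> root_polytope (T - {f})" for f
  proof -
    have "(if f = \<epsilon> then 0 else 1 / n) = cut_form (head_side T f) p"
      unfolding p' by (rule cut_form_sum[OF ac f(1), symmetric])
    also have "\<dots> = 0" using f root_polytope_forest(2)[OF ac f(1) pT] by blast
    finally show ?thesis using n by (simp split: if_splits)
  qed
  thus thesis using that p by blast
qed

text \<open>
  A facet of the simplex that is contained in a union of facets is one of them, since its private
  point lies on no other facet.
\<close>

lemma facets_in_earlier:
  assumes J: "jaeger T"
  shows "{F. F facet_of root_polytope T \<and> F \<subseteq> earlier T}
    = (\<lambda>\<epsilon>. root_polytope (T - {\<epsilon>})) ` {\<epsilon>. replaceable T \<epsilon>}" (is "?L = ?R")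
proof (intro equalityI subsetI)
  note T = jaegerD(1)[OF J]
  fix F assume "F \<in> ?L"
  then obtain \<epsilon> where \<epsilon>: "\<epsilon> \<in> T" "F = root_polytope (T - {\<epsilon>})" "2 \<le> card T" "F \<subseteq> earlier T"
    by (auto simp: facet_of_tree_simplex_iff[OF T])
  obtain p where p: "p \<in> F" "\<And>f. f \<in> T \<Longrightarrow> p \<in> root_polytope (T - {f}) \<Longrightarrow> f = \<epsilon>"
    using facet_has_private_point[OF T \<epsilon>(1,3)] \<epsilon>(2) by metis
  have "p \<in> root_polytope T \<inter> earlier T"
    using p(1) \<epsilon> root_polytope_mono[of "T - {\<epsilon>}" T] by blast
  then obtain f where "replaceable T f" "p \<in> root_polytope (T - {f})"
    unfolding intersection_with_earlier[OF J] by blast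
  moreover from this have "f = \<epsilon>" using p(2) by (simp add: replaceable_def)
  ultimately show "F \<in> ?R" using \<epsilon>(2) by blast
next
  note T = jaegerD(1)[OF J]
  fix F assume "F \<in> ?R"
  then obtain \<epsilon> where \<epsilon>: "replaceable T \<epsilon>" "F = root_polytope (T - {\<epsilon>})" by blast
  have "F facet_of root_polytope T"
    unfolding facet_of_tree_simplex_iff[OF T]
    using \<epsilon> replaceable_card_ge_2[OF T \<epsilon>(1)] by (auto simp: replaceable_def)
  moreover have "F \<subseteq> earlier T" using intersection_with_earlier[OF J] \<epsilon> by blast
  ultimately show "F \<in> ?L" by blast
qed

lemma card_facets_in_earlier:
  assumes J: "jaeger T"
  shows "card {F. F facet_of root_polytope T \<and> F \<subseteq> earlier T}
    = card {\<epsilon>. internally_semi_passive E (tour_less \<rho> b T) T \<epsilon>}"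
proof -
  note T = jaegerD(1)[OF J]
  have "inj_on (\<lambda>\<epsilon>. root_polytope (T - {\<epsilon>})) {\<epsilon>. replaceable T \<epsilon>}"
  proof (rule inj_onI)
    fix \<epsilon> \<delta> assume "\<epsilon> \<in> {\<epsilon>. replaceable T \<epsilon>}" "\<delta> \<in> {\<epsilon>. replaceable T \<epsilon>}"
      and eq: "root_polytope (T - {\<epsilon>}) = root_polytope (T - {\<delta>})"
    hence \<delta>: "\<delta> \<in> T" by (simp add: replaceable_def)
    show "\<epsilon> = \<delta>"
    proof (rule ccontr)
      assume "\<epsilon> \<noteq> \<delta>"
      hence "edge_vec \<delta> \<in> root_polytope (T - {\<epsilon>})"
        unfolding root_polytope_eq by (intro hull_inc) (use \<delta> in blast)
      thus False using eq vertex_not_in_opposite_facet(2)[OF T \<delta>] by simp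
    qed
  qed
  thus ?thesis
    unfolding facets_in_earlier[OF J] semi_passive_iff_replaceable[OF J] by (rule card_image)
qed

section \<open>The dissection and its shelling\<close>

lemma jaeger_simplices_differ:
  assumes J: "jaeger T" and J': "jaeger T'" and neq: "T \<noteq> T'"
  shows "root_polytope T \<noteq> root_polytope T'"
    and "rel_interior (root_polytope T) \<inter> rel_interior (root_polytope T') = {}"
proof -
  have main: "root_polytope T \<noteq> root_polytope T' \<and>
      rel_interior (root_polytope T) \<inter> rel_interior (root_polytope T') = {}"
    if J: "jaeger T" and J': "jaeger T'" and prec: "T' \<sqsubset> T" for T T'
  proof -
    note T = jaegerD(1)[OF J]
    obtain \<epsilon> where \<epsilon>: "replaceable T \<epsilon>" "root_polytope T \<inter> root_polytope T' \<subseteq> root_polytope (T - {\<epsilon>})"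
      using jaeger_intersection[OF J J' prec] by blast
    have \<epsilon>T: "\<epsilon> \<in> T" using \<epsilon>(1) by (simp add: replaceable_def)
    show ?thesis
      using \<epsilon>(2) vertex_not_in_opposite_facet[OF T \<epsilon>T] rel_interior_tree_simplex[OF T \<epsilon>T]
        rel_interior_subset[of "root_polytope T"] rel_interior_subset[of "root_polytope T'"] by blast
  qed
  have "T' \<sqsubset> T \<or> T \<sqsubset> T'" using tree_prec_total[OF jaegerD(1)[OF J] jaegerD(1)[OF J']] neq by blast
  thus "root_polytope T \<noteq> root_polytope T'"
    "rel_interior (root_polytope T) \<inter> rel_interior (root_polytope T') = {}"
    using main[OF J J'] main[OF J' J] by auto
qed

lemma jaeger_dissection:
  "dissection (root_polytope E) (root_polytope ` {T. jaeger T})"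
  unfolding dissection_def
proof (intro conjI ballI impI)
  fix \<sigma> assume "\<sigma> \<in> root_polytope ` {T. jaeger T}"
  thus "aff_dim (root_polytope E) simplex \<sigma>" using tree_simplex jaegerD(1) by auto
next
  fix \<sigma> \<tau> assume "\<sigma> \<in> root_polytope ` {T. jaeger T}" "\<tau> \<in> root_polytope ` {T. jaeger T}" "\<sigma> \<noteq> \<tau>"
  then obtain T T' where "jaeger T" "jaeger T'" "T \<noteq> T'" "\<sigma> = root_polytope T" "\<tau> = root_polytope T'"
    by auto
  thus "rel_interior \<sigma> \<inter> rel_interior \<tau> = {}" using jaeger_simplices_differ(2) by simp
next
  show "\<Union> (root_polytope ` {T. jaeger T}) = root_polytope E"
  proof (intro equalityI subsetI)
    fix p assume "p \<in> \<Union> (root_polytope ` {T. jaeger T})"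
    then obtain T where T: "jaeger T" "p \<in> root_polytope T" by blast
    thus "p \<in> root_polytope E"
      using root_polytope_mono[OF spanning_treeD(1)[OF jaegerD(1)[OF T(1)]]] by blast
  next
    fix p assume "p \<in> root_polytope E"
    then obtain T where "und_spanning_tree E T" "p \<in> root_polytope T"
      by (rule root_polytope_covered_by_trees)
    then obtain T' where "jaeger T'" "p \<in> root_polytope T'" using jaeger_tree_below by metis
    thus "p \<in> \<Union> (root_polytope ` {T. jaeger T})" by blast
  qed
qed

lemma jaeger_shelling:
  "\<exists>Ts. distinct Ts \<and> set Ts = {T. jaeger T} \<and> sorted_wrt (\<sqsubset>) Ts
     \<and> shelling_order (root_polytope ` {T. jaeger T}) (map root_polytope Ts)"
proof -
  have "transp_on {T. jaeger T} (\<sqsubset>)"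
  proof (rule transp_onI)
    fix T1 T2 T3 assume "T1 \<in> {T. jaeger T}" "T2 \<in> {T. jaeger T}" "T3 \<in> {T. jaeger T}"
      and "T1 \<sqsubset> T2" "T2 \<sqsubset> T3"
    thus "T1 \<sqsubset> T3" using tree_prec_trans[of T1 T2 T3] jaegerD(1) by simp
  qed
  moreover have "totalp_on {T. jaeger T} (\<sqsubset>)"
  proof (rule totalp_onI)
    fix T T' assume "T \<in> {T. jaeger T}" "T' \<in> {T. jaeger T}" "T \<noteq> T'"
    thus "T \<sqsubset> T' \<or> T' \<sqsubset> T" using tree_prec_total[of T' T] jaegerD(1) by simp
  qed
  ultimately obtain Ts where Ts: "distinct Ts" "set Ts = {T. jaeger T}" "sorted_wrt (\<sqsubset>) Ts"
    using ex_sorted_wrt_list[of "{T. jaeger T}" "(\<sqsubset>)"] by auto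
  have "inj_on root_polytope {T. jaeger T}"
    by (rule inj_onI) (use jaeger_simplices_differ(1) in blast)
  hence "distinct (map root_polytope Ts)" using Ts by (simp add: distinct_map)
  moreover have "\<exists>\<F>. \<F> \<noteq> {} \<and> (\<forall>F\<in>\<F>. F facet_of (map root_polytope Ts ! i)) \<and>
      map root_polytope Ts ! i \<inter> (\<Union>j<i. map root_polytope Ts ! j) = \<Union>\<F>"
    if i: "0 < i" "i < length Ts" for i
  proof -
    let ?T = "Ts ! i"
    have J: "jaeger (Ts ! j)" if "j < length Ts" for j using nth_mem[OF that] Ts(2) by blast
    have less: "Ts ! j \<sqsubset> Ts ! k" if "j < k" "k < length Ts" for j k
      using sorted_wrt_nth_less[OF Ts(3) that] .
    have "{T'. jaeger T' \<and> T' \<sqsubset> ?T} = (!) Ts ` {..<i}"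
    proof (intro equalityI subsetI)
      fix T' assume "T' \<in> {T'. jaeger T' \<and> T' \<sqsubset> ?T}"
      then obtain j where j: "j < length Ts" "T' = Ts ! j" "Ts ! j \<sqsubset> ?T"
        using Ts(2) by (metis in_set_conv_nth mem_Collect_eq)
      have "\<not> i \<le> j"
        using j less[of i j] tree_prec_irrefl
          tree_prec_trans[OF jaegerD(1)[OF J[OF j(1)]] jaegerD(1)[OF J[OF i(2)]] jaegerD(1)[OF J[OF j(1)]]]
        by (auto simp: le_less)
      thus "T' \<in> (!) Ts ` {..<i}" using j by auto
    qed (use i J less in auto)
    hence earlier: "earlier ?T = (\<Union>j<i. map root_polytope Ts ! j)"
      unfolding earlier_def using i by auto
    let ?F = "{F. F facet_of root_polytope ?T \<and> F \<subseteq> earlier ?T}"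
    have "root_polytope ?T \<inter> earlier ?T = \<Union>?F"
      unfolding facets_in_earlier[OF J[OF i(2)]] intersection_with_earlier[OF J[OF i(2)]] ..
    moreover have "?F \<noteq> {}"
      unfolding facets_in_earlier[OF J[OF i(2)]]
      using jaeger_intersection[OF J[OF i(2)] J[of 0] less[of 0 i]] i by fastforce
    ultimately show ?thesis
      unfolding earlier[symmetric] using i by (intro exI[of _ ?F]) simp
  qed
  ultimately have "shelling_order (root_polytope ` {T. jaeger T}) (map root_polytope Ts)"
    unfolding shelling_order_def using Ts(2) by auto
  thus ?thesis using Ts by blast
qed

end

theorem theorem6p2:
  fixes E :: "('v::finite) edge set"
    and \<rho> :: "'v ribbon"
    and b :: "'v \<times> 'v edge"
  assumes "asym E"
    and "Digraph_Component.connected (graph_of E)"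
    and "semi_balanced E"
    and "ribbon_structure E \<rho>"
    and "is_basis E b"
  shows "dissection (root_polytope E) (root_polytope ` {T. jaeger_tree E \<rho> b T})
    \<and> (\<exists>Ts. distinct Ts \<and> set Ts = {T. jaeger_tree E \<rho> b T} \<and> sorted_wrt (tree_prec \<rho> b) Ts
          \<and> shelling_order (root_polytope ` {T. jaeger_tree E \<rho> b T}) (map root_polytope Ts))
    \<and> (\<forall>T. jaeger_tree E \<rho> b T \<longrightarrow>
          card {F. F facet_of root_polytope T \<and>
                   F \<subseteq> (\<Union>T' \<in> {T'. jaeger_tree E \<rho> b T' \<and> tree_prec \<rho> b T' T}. root_polytope T')}
          = card {\<epsilon>. internally_semi_passive E (tour_less \<rho> b T) T \<epsilon>})"
proof -
  interpret ribbon_digraph E \<rho> b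
    using assms by unfold_locales (auto simp: connected_graph_of_iff)
  show ?thesis
    using jaeger_dissection jaeger_shelling card_facets_in_earlier unfolding earlier_def by blast
qed

end
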